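(* Let $A,B,C,D,K$ be non-negative half-integers (elements of $\tfrac12\mathbb{Z}_{\ge0}$) such that $2K$, $2A+2D$ and $2B+2C$ have the same parity and $$\max\{|A-D|,|B-C|\}\le K\le\min\{A+D,B+C\}.$$ Then there exists a family, not identically zero, of complex $(2A+1)(2B+1)\times(2C+1)(2D+1)$ matrices $T^{\mu_1\mu_2\cdots\mu_{2K}}$, $\mu_1,\dots,\mu_{2K}\in\{0,1,2,3\}$, such that: (1) $T^{\mu_1\cdots\mu_{2K}}$ is symmetric in the indices $\mu_1,\dots,\mu_{2K}$; (2) $T$ is traceless: $g_{\mu_1\mu_2}T^{\mu_1\mu_2\cdots\mu_{2K}}=0$; (3) for all $\Lambda\in SL(2,\mathbb{C})$, $$D^{AB}(\Lambda)\,T^{\mu_1\mu_2\cdots\mu_{2K}}\,D^{CD}(\Lambda)^\dagger=\Lambda_{\nu_1}{}^{\mu_1}\Lambda_{\nu_2}{}^{\mu_2}\cdots\Lambda_{\nu_{2K}}{}^{\mu_{2K}}\,T^{\nu_1\nu_2\cdots\nu_{2K}}.$$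
   Context: Repeated indices are summed. The Minkowski metric is $g_{11}=g_{22}=g_{33}=1$, $g_{00}=-1$, other components zero. The covering $\lambda:SL(2,\mathbb{C})\to SO^+(1,3)$ is given by $X(\lambda(\Lambda)p)=\Lambda X(p)\Lambda^\dagger$, where $X(p)=p^0I-\mathbf p\cdot\boldsymbol\sigma$ ($\boldsymbol\sigma$ the Pauli matrices). Writing $\Lambda^\mu{}_\nu$ for the matrix of $\lambda(\Lambda)$, $\Lambda_\nu{}^\mu=g_{\nu\rho}g^{\mu\sigma}\Lambda^\rho{}_\sigma=(\Lambda^{-1})^\mu{}_\nu$. Condition (2) is vacuous if $2K<2$, and for $K=0$ the family is a single matrix. $D^{(s)}$ is the spin-$s$ irreducible representation of $SU(2)$ of dimension $2s+1$, unitary in its standard basis, extended holomorphically to $SL(2,\mathbb{C})$; $D^{AB}(\Lambda)=D^{(A)}(\Lambda)\otimes D^{(B)}((\Lambda^\dagger)^{-1})$ is the $(A,B)$ irreducible representation of $SL(2,\mathbb{C})$. *)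

theory Defs
  imports
    Jordan_Normal_Form.Schur_Decomposition
    Jordan_Normal_Form.Gauss_Jordan_Elimination
    "HOL-Combinatorics.Permutations"
begin

definition half_integers_nonneg :: "real set" where
  "half_integers_nonneg = range (\<lambda>n :: nat. real n / 2)"

(* 2s as a natural number, for s in half_integers_nonneg *)
definition twice :: "real \<Rightarrow> nat" where
  "twice s = nat \<lfloor>2 * s\<rfloor>"

lemma twice_half [simp]: "twice (real n / 2) = n"
  by (simp add: twice_def)

definition SL2C :: "complex mat set" where
  "SL2C = {\<Lambda> \<in> carrier_mat 2 2. det \<Lambda> = 1}"

(* Spin-s representation as the 2s-th symmetric power of the defining representation.
   With n = 2s and the basis (e_0, ..., e_n), e_k = sqrt (n choose k) * u^(n-k) * v^k,
   of the homogeneous polynomials of degree n in u, v, which is the standard basis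
   |s, m> with m = s - k, the matrix M = ((a, b), (c, d)) acts by u |-> a u + c v and
   v |-> b u + d v.  Setting u = 1 turns (a u + c v)^(n-k) * (b u + d v)^k into the
   univariate polynomial below, whose j-th coefficient is that of u^(n-j) * v^j.
   The entries are polynomial in those of M, so this is the holomorphic extension
   from SU(2).  See spin_rep_mult, spin_rep_one, spin_rep_unitary and spin_rep_half below. *)
definition spin_rep :: "real \<Rightarrow> complex mat \<Rightarrow> complex mat" where
  "spin_rep s M = (let n = twice s in
     mat (n + 1) (n + 1) (\<lambda>(j, k).
       complex_of_real (sqrt (real (n choose k)) / sqrt (real (n choose j))) *
       coeff ([: M $$ (0,0), M $$ (1,0) :] ^ (n - k) * [: M $$ (0,1), M $$ (1,1) :] ^ k) j))"

definition kronecker :: "complex mat \<Rightarrow> complex mat \<Rightarrow> complex mat" where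
  "kronecker P Q = mat (dim_row P * dim_row Q) (dim_col P * dim_col Q) (\<lambda>(i, j).
     P $$ (i div dim_row Q, j div dim_col Q) * Q $$ (i mod dim_row Q, j mod dim_col Q))"

(* mat_adjoint is the conjugate transpose; mat_inverse returns Some for invertible arguments *)
definition spin_rep2 :: "real \<Rightarrow> real \<Rightarrow> complex mat \<Rightarrow> complex mat" where
  "spin_rep2 A B \<Lambda> = kronecker (spin_rep A \<Lambda>) (spin_rep B (the (mat_inverse (mat_adjoint \<Lambda>))))"

definition spin_dim :: "real \<Rightarrow> real \<Rightarrow> nat" where
  "spin_dim A B = (twice A + 1) * (twice B + 1)"

definition pauli :: "nat \<Rightarrow> complex mat" where
  "pauli k = mat_of_rows_list 2
     (if k = 1 then [[0, 1], [1, 0]]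
      else if k = 2 then [[0, - \<i>], [\<i>, 0]]
      else [[1, 0], [0, - 1]])"

definition momentum_mat :: "real vec \<Rightarrow> complex mat" where
  "momentum_mat p = complex_of_real (p $ 0) \<cdot>\<^sub>m 1\<^sub>m 2 -
     (complex_of_real (p $ 1) \<cdot>\<^sub>m pauli 1 + complex_of_real (p $ 2) \<cdot>\<^sub>m pauli 2
      + complex_of_real (p $ 3) \<cdot>\<^sub>m pauli 3)"

definition covers :: "complex mat \<Rightarrow> real mat \<Rightarrow> bool" where
  "covers \<Lambda> L \<longleftrightarrow> L \<in> carrier_mat 4 4 \<and>
     (\<forall>p \<in> carrier_vec 4. momentum_mat (L *\<^sub>v p) = \<Lambda> * momentum_mat p * mat_adjoint \<Lambda>)"

(* THE is justified by ex1_covers below *)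
definition lorentz :: "complex mat \<Rightarrow> real mat" where
  "lorentz \<Lambda> = (THE L. covers \<Lambda> L)"

definition minkowski :: "nat \<Rightarrow> nat \<Rightarrow> real" where
  "minkowski \<mu> \<nu> = (if \<mu> = \<nu> then if \<mu> = 0 then - 1 else 1 else 0)"

(* lorentz_low \<Lambda> \<nu> \<mu> has \<nu> as lower first and \<mu> as upper second index; the matrix of
   the metric is its own inverse, so it also serves as the metric with upper indices *)
definition lorentz_low :: "complex mat \<Rightarrow> nat \<Rightarrow> nat \<Rightarrow> real" where
  "lorentz_low \<Lambda> \<nu> \<mu> =
     (\<Sum>\<rho><4. \<Sum>\<sigma><4. minkowski \<nu> \<rho> * minkowski \<mu> \<sigma> * lorentz \<Lambda> $$ (\<rho>, \<sigma>))"

(* A tensor with m upper indices is a function on multi-indices *)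
definition multi_indices :: "nat \<Rightarrow> nat list set" where
  "multi_indices m = {\<mu>. length \<mu> = m \<and> set \<mu> \<subseteq> {..<4}}"

(* The type of matrices of unspecified size is no additive monoid, so sum does not apply *)
definition mat_sum :: "nat \<Rightarrow> nat \<Rightarrow> ('i \<Rightarrow> complex mat) \<Rightarrow> 'i set \<Rightarrow> complex mat" where
  "mat_sum nr nc f I = mat nr nc (\<lambda>ij. \<Sum>x\<in>I. f x $$ ij)"

definition symmetric_tensor :: "nat \<Rightarrow> (nat list \<Rightarrow> complex mat) \<Rightarrow> bool" where
  "symmetric_tensor m T \<longleftrightarrow>
     (\<forall>\<pi> \<mu>. \<pi> permutes {..<m} \<longrightarrow> \<mu> \<in> multi_indices m \<longrightarrow> T (permute_list \<pi> \<mu>) = T \<mu>)"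

definition traceless_tensor ::
  "nat \<Rightarrow> nat \<Rightarrow> nat \<Rightarrow> (nat list \<Rightarrow> complex mat) \<Rightarrow> bool" where
  "traceless_tensor nr nc m T \<longleftrightarrow>
     (2 \<le> m \<longrightarrow> (\<forall>\<mu> \<in> multi_indices (m - 2).
        mat_sum nr nc (\<lambda>(\<alpha>, \<beta>). complex_of_real (minkowski \<alpha> \<beta>) \<cdot>\<^sub>m T (\<alpha> # \<beta> # \<mu>))
          ({..<4} \<times> {..<4}) = 0\<^sub>m nr nc))"

lemma mat_adjoint_carrier [simp]: "P \<in> carrier_mat m n \<Longrightarrow> mat_adjoint P \<in> carrier_mat n m"
  by (auto simp: mat_adjoint_def)

lemma mat_adjoint_index:
  assumes "P \<in> carrier_mat m n" "i < n" "j < m"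
  shows "mat_adjoint P $$ (i, j) = cnj (P $$ (j, i))"
  using assms by (simp add: mat_adjoint_def mat_of_rows_def conjugate_complex_def)

lemma momentum_mat_carrier [simp]: "momentum_mat p \<in> carrier_mat 2 2"
  by (auto simp: momentum_mat_def pauli_def mat_of_rows_list_def intro!: minus_carrier_mat add_carrier_mat)

lemma momentum_mat_index:
  "momentum_mat p $$ (0, 0) = p $ 0 - p $ 3"
  "momentum_mat p $$ (0, Suc 0) = - p $ 1 + \<i> * p $ 2"
  "momentum_mat p $$ (Suc 0, 0) = - p $ 1 - \<i> * p $ 2"
  "momentum_mat p $$ (Suc 0, Suc 0) = p $ 0 + p $ 3"
  by (simp_all add: momentum_mat_def pauli_def mat_of_rows_list_def)

lemma mat2_eqI:
  assumes "P \<in> carrier_mat 2 2" "Q \<in> carrier_mat 2 2"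
    and "P $$ (0, 0) = Q $$ (0, 0)" "P $$ (0, Suc 0) = Q $$ (0, Suc 0)"
    "P $$ (Suc 0, 0) = Q $$ (Suc 0, 0)" "P $$ (Suc 0, Suc 0) = Q $$ (Suc 0, Suc 0)"
  shows "P = Q"
  using assms by (intro eq_matI) (auto simp: less_Suc_eq numeral_2_eq_2)

lemma mat2_mult_index:
  assumes "P \<in> carrier_mat 2 2" "Q \<in> carrier_mat 2 2" "i < 2" "j < 2"
  shows "(P * Q) $$ (i, j) = P $$ (i, 0) * Q $$ (0, j) + P $$ (i, Suc 0) * Q $$ (Suc 0, j)"
  using assms by (simp add: scalar_prod_def numeral_2_eq_2)

lemma ex1_covers:
  assumes "\<Lambda> \<in> carrier_mat 2 2"
  shows "\<exists>!L. covers \<Lambda> L"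
proof (rule ex_ex1I)
  define H where "H p = \<Lambda> * momentum_mat p * mat_adjoint \<Lambda>" for p
  define h where "h \<mu> p = (if \<mu> = 0 then Re (H p $$ (0, 0) + H p $$ (Suc 0, Suc 0)) / 2
      else if \<mu> = 1 then - Re (H p $$ (0, Suc 0))
      else if \<mu> = 2 then Im (H p $$ (0, Suc 0))
      else Re (H p $$ (Suc 0, Suc 0) - H p $$ (0, 0)) / 2)" for \<mu> :: nat and p
  define L where "L = mat 4 4 (\<lambda>(\<mu>, \<nu>). h \<mu> (unit_vec 4 \<nu>))"
  note four = less_Suc_eq numeral_eq_Suc
  have Hc: "H p \<in> carrier_mat 2 2" for p
    using assms unfolding H_def by (metis mult_carrier_mat mat_adjoint_carrier momentum_mat_carrier)
  have Hi: "H p $$ (i, j) =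
      (\<Lambda> $$ (i, 0) * momentum_mat p $$ (0, 0) + \<Lambda> $$ (i, Suc 0) * momentum_mat p $$ (Suc 0, 0)) * cnj (\<Lambda> $$ (j, 0)) +
      (\<Lambda> $$ (i, 0) * momentum_mat p $$ (0, Suc 0) + \<Lambda> $$ (i, Suc 0) * momentum_mat p $$ (Suc 0, Suc 0)) * cnj (\<Lambda> $$ (j, Suc 0))"
    if "i < 2" "j < 2" for p i j
    unfolding H_def using assms that
    by (subst mat2_mult_index)
      (auto simp: mat2_mult_index mat_adjoint_index[OF assms] intro!: mult_carrier_mat)
  have lin: "h \<mu> p = (\<Sum>\<nu><4. h \<mu> (unit_vec 4 \<nu>) * p $ \<nu>)"
    if "\<mu> < 4" "p \<in> carrier_vec 4" for \<mu> p
    using that(1)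
    by (simp add: h_def Hi momentum_mat_index four unit_vec_def)
       (auto simp: algebra_simps add_divide_distrib diff_divide_distrib)
  have Lp: "(L *\<^sub>v p) $ \<mu> = h \<mu> p" if "\<mu> < 4" "p \<in> carrier_vec 4" for \<mu> p
    using that lin[OF that] by (simp add: L_def scalar_prod_def atLeast0LessThan)
  have "momentum_mat (L *\<^sub>v p) = H p" if "p \<in> carrier_vec 4" for p
  proof (rule mat2_eqI)
    show "momentum_mat (L *\<^sub>v p) $$ (0, 0) = H p $$ (0, 0)"
      by (simp add: momentum_mat_index Lp that h_def)
        (simp add: complex_eq_iff Hi momentum_mat_index field_simps)
    show "momentum_mat (L *\<^sub>v p) $$ (0, Suc 0) = H p $$ (0, Suc 0)"
      by (simp add: momentum_mat_index Lp that h_def complex_eq_iff)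
    show "momentum_mat (L *\<^sub>v p) $$ (Suc 0, 0) = H p $$ (Suc 0, 0)"
      by (simp add: momentum_mat_index Lp that h_def)
        (simp add: complex_eq_iff Hi momentum_mat_index field_simps)
    show "momentum_mat (L *\<^sub>v p) $$ (Suc 0, Suc 0) = H p $$ (Suc 0, Suc 0)"
      by (simp add: momentum_mat_index Lp that h_def)
        (simp add: complex_eq_iff Hi momentum_mat_index field_simps)
  qed (use Hc in auto)
  then have "covers \<Lambda> L"
    by (simp add: covers_def H_def L_def)
  then show "\<exists>L. covers \<Lambda> L" ..
next
  fix L L' assume "covers \<Lambda> L" "covers \<Lambda> L'"
  then have L: "L \<in> carrier_mat 4 4" "L' \<in> carrier_mat 4 4"
    and eq: "\<And>p. p \<in> carrier_vec 4 \<Longrightarrow> momentum_mat (L *\<^sub>v p) = momentum_mat (L' *\<^sub>v p)"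
    by (auto simp: covers_def)
  have inj: "p $ \<mu> = q $ \<mu>" if "momentum_mat p = momentum_mat q" "\<mu> < 4" for p q \<mu>
  proof -
    have "momentum_mat p $$ ij = momentum_mat q $$ ij" for ij using that(1) by simp
    from this[of "(0, 0)"] this[of "(0, Suc 0)"] this[of "(Suc 0, Suc 0)"] that(2)
    show ?thesis
      by (auto simp: momentum_mat_index complex_eq_iff less_Suc_eq numeral_eq_Suc)
  qed
  show "L = L'"
  proof (rule eq_matI)
    fix i j assume "i < dim_row L'" "j < dim_col L'"
    then have ij: "i < 4" "j < 4" using L by auto
    have "(L *\<^sub>v unit_vec 4 j) $ i = (L' *\<^sub>v unit_vec 4 j) $ i"
      using ij by (intro inj eq) auto
    then show "L $$ (i, j) = L' $$ (i, j)" using ij L by simp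
  qed (use L in auto)
qed

lemma covers_lorentz:
  assumes "\<Lambda> \<in> carrier_mat 2 2"
  shows "covers \<Lambda> (lorentz \<Lambda>)"
  unfolding lorentz_def by (rule theI'[OF ex1_covers[OF assms]])

definition spin_poly :: "nat \<Rightarrow> complex mat \<Rightarrow> nat \<Rightarrow> complex poly" where
  "spin_poly n M k = [: M $$ (0,0), M $$ (1,0) :] ^ (n - k) * [: M $$ (0,1), M $$ (1,1) :] ^ k"

(* Homogenisation of p to degree n, evaluated at (U, V) *)
definition hom_subst :: "nat \<Rightarrow> complex poly \<Rightarrow> complex poly \<Rightarrow> complex poly \<Rightarrow> complex poly" where
  "hom_subst n p U V = (\<Sum>j\<le>n. smult (coeff p j) (U ^ (n - j) * V ^ j))"

lemma hom_subst_linear: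
  assumes "degree p \<le> n"
  shows "hom_subst (Suc n) ([:a, b:] * p) U V = (smult a U + smult b V) * hom_subst n p U V"
proof -
  have c: "coeff ([:a, b:] * p) j = a * coeff p j + (if j = 0 then 0 else b * coeff p (j - 1))" for j
    by (cases j) auto
  have "hom_subst (Suc n) ([:a, b:] * p) U V =
      (\<Sum>j\<le>Suc n. smult (a * coeff p j) (U ^ (Suc n - j) * V ^ j)) +
      (\<Sum>j\<le>Suc n. smult (if j = 0 then 0 else b * coeff p (j - 1)) (U ^ (Suc n - j) * V ^ j))"
    unfolding hom_subst_def by (simp only: c smult_add_left sum.distrib)
  also have "(\<Sum>j\<le>Suc n. smult (a * coeff p j) (U ^ (Suc n - j) * V ^ j)) =
      (\<Sum>j\<le>n. smult (a * coeff p j) (U ^ (Suc n - j) * V ^ j))"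
    using assms by (simp add: coeff_eq_0)
  also have "\<dots> = smult a U * hom_subst n p U V"
    unfolding hom_subst_def sum_distrib_left
    by (rule sum.cong) (auto simp: Suc_diff_le mult_ac)
  also have "(\<Sum>j\<le>Suc n. smult (if j = 0 then 0 else b * coeff p (j - 1)) (U ^ (Suc n - j) * V ^ j)) =
      smult b V * hom_subst n p U V"
    unfolding hom_subst_def sum_distrib_left sum.atMost_Suc_shift
    by (simp add: mult_ac)
  finally show ?thesis by (simp add: algebra_simps)
qed

lemma hom_subst_spin_poly:
  assumes "k \<le> n"
  shows "hom_subst n (spin_poly n M k) U V =
    (smult (M $$ (0,0)) U + smult (M $$ (1,0)) V) ^ (n - k) *
    (smult (M $$ (0,1)) U + smult (M $$ (1,1)) V) ^ k"
proof -
  have deg: "degree ([:a, b:] ^ i * [:c, d:] ^ k) \<le> i + k" for a b c d :: complex and i k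
  proof -
    have lin: "degree [:a, b:] \<le> 1" for a b :: complex by simp
    have "degree ([:a, b:] ^ m) \<le> m" for a b :: complex and m
      by (rule order_trans[OF degree_power_le]) (use lin[of a b] in simp)
    then show ?thesis
      by (intro order_trans[OF degree_mult_le] add_mono)
  qed
  have 0: "hom_subst k ([:c, d:] ^ k) U V = (smult c U + smult d V) ^ k" for c d k
  proof (induction k)
    case (Suc k)
    then show ?case using hom_subst_linear[of "[:c, d:] ^ k" k c d U V] deg[of 0 0 0 c d k] by simp
  qed (simp add: hom_subst_def)
  have "hom_subst (i + k) ([:a, b:] ^ i * [:c, d:] ^ k) U V =
      (smult a U + smult b V) ^ i * (smult c U + smult d V) ^ k" for a b c d i
  proof (induction i)
    case (Suc i)
    then show ?case
      using hom_subst_linear[OF deg[of a b i c d k], of a b U V]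
      by (simp only: power_Suc add_Suc mult.assoc)
  qed (simp add: 0)
  from this[of "n - k"] show ?thesis using assms by (simp add: spin_poly_def)
qed

lemma spin_rep_carrier [simp]: "spin_rep s M \<in> carrier_mat (twice s + 1) (twice s + 1)"
  by (simp add: spin_rep_def Let_def)

lemma spin_rep_index:
  assumes "j \<le> twice s" "k \<le> twice s"
  shows "spin_rep s M $$ (j, k) =
    complex_of_real (sqrt (real (twice s choose k)) / sqrt (real (twice s choose j))) *
    coeff (spin_poly (twice s) M k) j"
  using assms by (simp add: spin_rep_def Let_def spin_poly_def)

lemma spin_rep_mult:
  assumes "M \<in> carrier_mat 2 2" "N \<in> carrier_mat 2 2"
  shows "spin_rep s (M * N) = spin_rep s M * spin_rep s N"
proof (rule eq_matI)
  let ?n = "twice s"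
  fix i k assume "i < dim_row (spin_rep s M * spin_rep s N)" "k < dim_col (spin_rep s M * spin_rep s N)"
  then have ik: "i \<le> ?n" "k \<le> ?n"
    by (simp_all add: spin_rep_def Let_def)
  have MN: "(M * N) $$ (p, q) = M $$ (p, 0) * N $$ (0, q) + M $$ (p, Suc 0) * N $$ (Suc 0, q)"
    if "p < 2" "q < 2" for p q
    using assms that by (simp add: scalar_prod_def numeral_2_eq_2)
  have "spin_poly ?n (M * N) k = hom_subst ?n (spin_poly ?n N k)
      [: M $$ (0,0), M $$ (1,0) :] [: M $$ (0,1), M $$ (1,1) :]"
    using ik by (simp add: hom_subst_spin_poly) (simp add: spin_poly_def MN mult_ac)
  then have "spin_poly ?n (M * N) k = (\<Sum>j\<le>?n. smult (coeff (spin_poly ?n N k) j) (spin_poly ?n M j))"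
    by (simp add: hom_subst_def spin_poly_def)
  then have c: "coeff (spin_poly ?n (M * N) k) i =
      (\<Sum>j\<le>?n. coeff (spin_poly ?n M j) i * coeff (spin_poly ?n N k) j)"
    by (simp add: coeff_sum mult_ac)
  have "(spin_rep s M * spin_rep s N) $$ (i, k) = (\<Sum>j\<le>?n. spin_rep s M $$ (i, j) * spin_rep s N $$ (j, k))"
    using ik spin_rep_carrier[of s M] spin_rep_carrier[of s N]
    by (simp add: scalar_prod_def atLeast0LessThan lessThan_Suc_atMost)
  also have "\<dots> = (\<Sum>j\<le>?n. complex_of_real (sqrt (real (?n choose k)) / sqrt (real (?n choose i))) *
      (coeff (spin_poly ?n M j) i * coeff (spin_poly ?n N k) j))"
    by (intro sum.cong) (auto simp: spin_rep_index ik binomial_eq_0_iff)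
  also have "\<dots> = spin_rep s (M * N) $$ (i, k)"
    by (simp only: c spin_rep_index ik sum_distrib_left)
  finally show "spin_rep s (M * N) $$ (i, k) = (spin_rep s M * spin_rep s N) $$ (i, k)" by simp
qed (simp_all add: spin_rep_def Let_def)

lemma spin_rep_one: "spin_rep s (1\<^sub>m 2) = 1\<^sub>m (twice s + 1)"
proof -
  have "[:0, 1:] ^ k = monom (1 :: complex) k" for k
    by (simp add: monom_altdef)
  then show ?thesis
    by (intro eq_matI) (auto simp: spin_rep_def Let_def one_pCons[symmetric] coeff_monom)
qed

lemma coeff_coeff_transpose_power:
  fixes a b c d :: complex
  shows "coeff (coeff ([:[:a, b:], [:c, d:]:] ^ n) k) j = coeff (coeff ([:[:a, c:], [:b, d:]:] ^ n) j) k"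
proof (induction n arbitrary: j k)
  case 0
  then show ?case by (auto simp: one_pCons coeff_pCons split: nat.splits)
next
  case (Suc n)
  let ?P = "[:[:a, b:], [:c, d:]:]" and ?Q = "[:[:a, c:], [:b, d:]:]"
  have 1: "coeff (coeff ?P k) j = coeff (coeff ?Q j) k" for j k
    by (auto simp: coeff_pCons split: nat.splits)
  have "coeff (coeff (?P * ?P ^ n) k) j = (\<Sum>i\<le>k. \<Sum>l\<le>j. coeff (coeff ?P i) l * coeff (coeff (?P ^ n) (k - i)) (j - l))"
    by (simp only: coeff_mult coeff_sum)
  also have "\<dots> = (\<Sum>i\<le>k. \<Sum>l\<le>j. coeff (coeff ?Q l) i * coeff (coeff (?Q ^ n) (j - l)) (k - i))"
    by (simp only: 1 Suc.IH)
  also have "\<dots> = (\<Sum>l\<le>j. \<Sum>i\<le>k. coeff (coeff ?Q l) i * coeff (coeff (?Q ^ n) (j - l)) (k - i))"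
    by (rule sum.swap)
  also have "\<dots> = coeff (coeff (?Q * ?Q ^ n) j) k"
    by (simp only: coeff_mult coeff_sum)
  finally show ?case by simp
qed

lemma binomial_coeff_transpose:
  fixes a b c d :: complex
  assumes "j \<le> n" "k \<le> n"
  shows "of_nat (n choose k) * coeff ([:a, b:] ^ (n - k) * [:c, d:] ^ k) j =
    of_nat (n choose j) * coeff ([:a, c:] ^ (n - j) * [:b, d:] ^ j) k"
  using coeff_coeff_transpose_power[of a b c d n k j] assms
  by (simp add: coeff_linear_poly_power of_nat_poly mult_ac)

lemma spin_rep_adjoint:
  assumes M: "M \<in> carrier_mat 2 2"
  shows "spin_rep s (mat_adjoint M) = mat_adjoint (spin_rep s M)"
proof (rule eq_matI)
  let ?n = "twice s"
  fix j k assume "j < dim_row (mat_adjoint (spin_rep s M))" "k < dim_col (mat_adjoint (spin_rep s M))"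
  then have jk: "j \<le> ?n" "k \<le> ?n"
    using mat_adjoint_carrier[OF spin_rep_carrier[of s M]] by auto
  have cnj_power: "cnj (coeff ([:a, b:] ^ p) i) = coeff ([:cnj a, cnj b:] ^ p) i" for a b p i
  proof (cases "i \<le> p")
    case False
    have "degree ([:a, b:] ^ p) \<le> p" for a b :: complex
      using degree_power_le[of "[:a, b:]" p] by (cases "b = 0") auto
    then show ?thesis using False by (metis coeff_eq_0 complex_cnj_zero le_less_trans not_le)
  qed (simp add: coeff_linear_poly_power)
  have cnj_coeff: "cnj (coeff ([:a, b:] ^ p * [:c, d:] ^ q) i) =
      coeff ([:cnj a, cnj b:] ^ p * [:cnj c, cnj d:] ^ q) i" for a b c d p q i
    by (simp add: coeff_mult cnj_power)
  let ?l = "coeff (spin_poly ?n (mat_adjoint M) k) j" and ?r = "cnj (coeff (spin_poly ?n M j) k)"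
  have "of_nat (?n choose k) * ?l = of_nat (?n choose j) * ?r"
    by (simp add: spin_poly_def cnj_coeff mat_adjoint_index[OF M]
      binomial_coeff_transpose[OF jk])
  moreover have "0 < real (?n choose j)" "0 < real (?n choose k)"
    using jk by simp_all
  moreover have "complex_of_real (sqrt x / sqrt y) * l = complex_of_real (sqrt y / sqrt x) * r"
    if "complex_of_real x * l = complex_of_real y * r" "0 < x" "0 < y" for x y l r
  proof -
    have *: "u / v * l = v / u * r" if "u * u * l = v * v * r" "u \<noteq> 0" "v \<noteq> 0" for u v :: complex
      using that by (simp add: field_simps)
    have "complex_of_real (sqrt x * sqrt x) * l = complex_of_real (sqrt y * sqrt y) * r"
      using that by (simp only: real_sqrt_mult_self abs_of_pos)
    moreover have "complex_of_real (sqrt x) \<noteq> 0" "complex_of_real (sqrt y) \<noteq> 0"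
      using that(2,3) by simp_all
    ultimately show ?thesis
      unfolding of_real_divide of_real_mult by (rule *)
  qed
  ultimately show "spin_rep s (mat_adjoint M) $$ (j, k) = mat_adjoint (spin_rep s M) $$ (j, k)"
    using jk by (simp add: mat_adjoint_index[OF spin_rep_carrier] spin_rep_index)
qed (use carrier_matD[OF mat_adjoint_carrier[OF spin_rep_carrier[of s M]]]
    carrier_matD[OF spin_rep_carrier[of s "mat_adjoint M"]] in simp_all)

lemma spin_rep_unitary:
  assumes "M \<in> carrier_mat 2 2" "M * mat_adjoint M = 1\<^sub>m 2"
  shows "spin_rep s M * mat_adjoint (spin_rep s M) = 1\<^sub>m (twice s + 1)"
  using assms by (metis spin_rep_adjoint spin_rep_mult spin_rep_one mat_adjoint_carrier)

lemma spin_rep_half: "M \<in> carrier_mat 2 2 \<Longrightarrow> spin_rep (1 / 2) M = M"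
  using twice_half[of 1]
  by (intro mat2_eqI) (auto simp: spin_rep_def Let_def numeral_2_eq_2)

end

(* Writing each vector index as a pair of spinor indices by means of the Pauli matrices, a symmetric
   traceless tensor with n = 2K indices is a pair of totally symmetric n-spinors, one undotted and one
   dotted.  So it suffices to find n-spinors P and Q of matrices that intertwine spin D with spin A and
   spin C with spin B.  With 2A = p + q, 2D = q + r, n = p + r, the trilinear form
   (x . w)^q (x . t)^p (w0 t1 - w1 t0)^r is invariant under x |-> M^T x, t |-> M^(-1) t, w |-> M^(-1) w,
   and its coefficients are the (rescaled) Clebsch-Gordan coefficients P. *)
theory Submission
  imports Defs
begin

section \<open>Sums over tuples\<close>

text \<open>Since \<open>spin_rep2\<close> takes its second factor at N = (M^dagger)^(-1), the
  adjoint of the (C, D) representation consists of spin C at M^dagger = N^(-1) and spin D at M^(-1).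
  Hence A is coupled with D through M, and B with C through N; this accounts for the two triangle
  conditions and for the crossed order of the indices. The entries of \<open>spin_rep\<close> are
  coefficients of polynomials, so covariance is proved by comparing generating functions: the action
  of M becomes a linear substitution in the trilinear form. A sum over rows gives a substitution
  directly, a sum over columns only after weighting with binomials; all binomial factors come from
  this asymmetry. That the tensor does not vanish is verified by a number: a contraction of one
  entry with a fixed complex vector in every slot factorises into values of the two trilinear forms
  at explicit points, both equal to 1.\<close>

definition tuples :: "nat \<Rightarrow> nat \<Rightarrow> nat list set" where
  "tuples d n = {xs. length xs = n \<and> set xs \<subseteq> {..<d}}"

text \<open>Vector multi-indices are the case d = 4; spinor multi-indices are the case d = 2, so
  that both kinds of sum obey the same lemmas.\<close>

lemma multi_indices_tuples: "multi_indices n = tuples 4 n"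
  by (simp add: multi_indices_def tuples_def)

lemma tuples_nth: "xs \<in> tuples d n \<Longrightarrow> j < n \<Longrightarrow> xs ! j < d"
  unfolding tuples_def using nth_mem by blast

lemma sum_tuples_Suc:
  fixes f :: "nat list \<Rightarrow> 'a :: comm_monoid_add"
  shows "(\<Sum>xs\<in>tuples d (Suc n). f xs) = (\<Sum>x<d. \<Sum>xs\<in>tuples d n. f (x # xs))"
proof -
  have "tuples d (Suc n) = (\<lambda>(x, xs). x # xs) ` ({..<d} \<times> tuples d n)"
    by (auto simp: tuples_def length_Suc_conv image_iff)
  moreover have "inj_on (\<lambda>(x, xs). x # xs) ({..<d} \<times> tuples d n)"
    by (auto simp: inj_on_def)
  ultimately show ?thesis
    by (simp add: sum.reindex sum.cartesian_product case_prod_unfold)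
qed

lemma tuples_0 [simp]: "tuples d 0 = {[]}"
  by (auto simp: tuples_def)

lemma sum_prod_tuples:
  fixes f :: "nat \<Rightarrow> nat \<Rightarrow> 'a :: comm_semiring_1"
  shows "(\<Sum>xs\<in>tuples d n. \<Prod>j<n. f j (xs ! j)) = (\<Prod>j<n. \<Sum>x<d. f j x)"
proof (induction n arbitrary: f)
  case (Suc n)
  have "(\<Sum>xs\<in>tuples d (Suc n). \<Prod>j<Suc n. f j (xs ! j)) =
      (\<Sum>x<d. f 0 x) * (\<Sum>xs\<in>tuples d n. \<Prod>j<n. f (Suc j) (xs ! j))"
    by (simp only: sum_tuples_Suc prod.lessThan_Suc_shift nth_Cons_0 nth_Cons_Suc
      sum_product)
  also have "\<dots> = (\<Prod>j<Suc n. \<Sum>x<d. f j x)"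
    using Suc.IH[of "\<lambda>j. f (Suc j)"] by (simp only: prod.lessThan_Suc_shift)
  finally show ?case .
qed simp

lemma degree_prod_linear:
  fixes f :: "nat \<Rightarrow> 'a :: comm_semiring_1 poly"
  assumes "\<And>j. j < n \<Longrightarrow> degree (f j) \<le> 1"
  shows "degree (\<Prod>j<n. f j) \<le> n"
  using assms
proof (induction n)
  case (Suc n)
  have "degree (\<Prod>j<Suc n. f j) \<le> degree (\<Prod>j<n. f j) + degree (f n)"
    by (simp add: degree_mult_le)
  also have "\<dots> \<le> n + 1" using Suc by (intro add_mono) auto
  finally show ?case by simp
qed simp

text \<open>Choosing the entry 1 in slot j contributes \<open>f j 1\<close> and one power of the
  variable, so the coefficient of degree m collects the tuples with entry sum m. Sums over tuples
  thus become sums over the components of a totally symmetric spinor.\<close>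

lemma sum_prod_tuples_2:
  fixes f :: "nat \<Rightarrow> nat \<Rightarrow> 'a :: comm_semiring_1" and g :: "nat \<Rightarrow> 'a"
  shows "(\<Sum>xs\<in>tuples 2 n. (\<Prod>j<n. f j (xs ! j)) * g (sum_list xs)) =
    (\<Sum>m\<le>n. coeff (\<Prod>j<n. [:f j 0, f j 1:]) m * g m)"
proof (induction n arbitrary: f g)
  case (Suc n)
  define p where "p = (\<Prod>j<n. [:f (Suc j) 0, f (Suc j) 1:])"
  have deg: "degree p \<le> n"
    unfolding p_def by (rule degree_prod_linear) simp
  have c: "coeff ([:a, b:] * p) j = a * coeff p j + (if j = 0 then 0 else b * coeff p (j - 1))" for a b j
    by (cases j) auto
  have "(\<Sum>xs\<in>tuples 2 (Suc n). (\<Prod>j<Suc n. f j (xs ! j)) * g (sum_list xs)) =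
    f 0 0 * (\<Sum>xs\<in>tuples 2 n. (\<Prod>j<n. f (Suc j) (xs ! j)) * g (sum_list xs)) +
    f 0 1 * (\<Sum>xs\<in>tuples 2 n. (\<Prod>j<n. f (Suc j) (xs ! j)) * g (Suc (sum_list xs)))"
    by (simp add: sum_tuples_Suc prod.lessThan_Suc_shift sum_distrib_left mult.assoc
      numeral_2_eq_2 del: prod.lessThan_Suc)
  also have "\<dots> = f 0 0 * (\<Sum>m\<le>n. coeff p m * g m) + f 0 1 * (\<Sum>m\<le>n. coeff p m * g (Suc m))"
    using Suc.IH[of "\<lambda>j. f (Suc j)" g] Suc.IH[of "\<lambda>j. f (Suc j)" "\<lambda>m. g (Suc m)"]
    by (simp only: p_def)
  also have "\<dots> = (\<Sum>m\<le>Suc n. f 0 0 * coeff p m * g m) +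
      (\<Sum>m\<le>Suc n. (if m = 0 then 0 else f 0 1 * coeff p (m - 1)) * g m)"
  proof -
    have "coeff p (Suc n) = 0" using deg by (simp add: coeff_eq_0)
    then have "(\<Sum>m\<le>Suc n. f 0 0 * coeff p m * g m) = f 0 0 * (\<Sum>m\<le>n. coeff p m * g m)"
      by (simp add: sum_distrib_left mult.assoc)
    moreover have "(\<Sum>m\<le>Suc n. (if m = 0 then 0 else f 0 1 * coeff p (m - 1)) * g m) =
        f 0 1 * (\<Sum>m\<le>n. coeff p m * g (Suc m))"
      by (simp add: sum.atMost_Suc_shift sum_distrib_left mult.assoc del: sum.atMost_Suc)
    ultimately show ?thesis by simp
  qed
  also have "\<dots> = (\<Sum>m\<le>Suc n. coeff ([:f 0 0, f 0 1:] * p) m * g m)"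
    by (simp only: c distrib_right sum.distrib)
  also have "[:f 0 0, f 0 1:] * p = (\<Prod>j<Suc n. [:f j 0, f j 1:])"
    by (simp only: p_def prod.lessThan_Suc_shift)
  finally show ?case .
qed simp

text \<open>Slot j contributes column \<open>xs ! j\<close> of M as a linear polynomial, and
  commutativity leaves only the numbers of zeros and ones.\<close>

lemma spin_poly_prod:
  assumes "xs \<in> tuples 2 n"
  shows "(\<Prod>j<n. [:M $$ (0, xs ! j), M $$ (1, xs ! j):]) = spin_poly n M (sum_list xs)"
proof -
  have *: "sum_list xs \<le> n \<and> (\<Prod>j<n. if xs ! j = 0 then X else Y) = X ^ (n - sum_list xs) * Y ^ sum_list xs"
    if "xs \<in> tuples 2 n" for X Y :: "complex poly" and xs n
    using that
  proof (induction n arbitrary: xs)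
    case (Suc n)
    then obtain y ys where xs: "xs = y # ys" "ys \<in> tuples 2 n" "y = 0 \<or> y = 1"
      by (fastforce simp: tuples_def length_Suc_conv less_2_cases_iff)
    then show ?case using Suc.IH[OF xs(2)]
      by (auto simp: prod.lessThan_Suc_shift Suc_diff_le simp del: prod.lessThan_Suc)
  qed simp
  have "(\<Prod>j<n. [:M $$ (0, xs ! j), M $$ (1, xs ! j):]) =
      (\<Prod>j<n. if xs ! j = 0 then [:M $$ (0, 0), M $$ (1, 0):] else [:M $$ (0, 1), M $$ (1, 1):])"
    by (intro prod.cong) (auto dest: tuples_nth[OF assms] simp: numeral_2_eq_2 less_Suc_eq)
  with *[OF assms] show ?thesis by (simp add: spin_poly_def)
qed

lemma sum_permute_tuples:
  assumes "\<pi> permutes {..<n}"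
  shows "(\<Sum>xs\<in>tuples d n. f (permute_list \<pi> xs)) = (\<Sum>xs\<in>tuples d n. f xs)"
proof (rule sum.reindex_bij_witness[where i = "permute_list (Hilbert_Choice.inv \<pi>)" and j = "permute_list \<pi>"])
  note inv = permutes_inv[OF assms]
  fix xs assume xs: "xs \<in> tuples d n"
  then have l: "length xs = n" by (simp add: tuples_def)
  show "permute_list (Hilbert_Choice.inv \<pi>) (permute_list \<pi> xs) = xs"
    using permute_list_compose[of "Hilbert_Choice.inv \<pi>" xs \<pi>] inv assms l by (simp add: permutes_inv_o)
  show "permute_list \<pi> (permute_list (Hilbert_Choice.inv \<pi>) xs) = xs"
    using permute_list_compose[of \<pi> xs "Hilbert_Choice.inv \<pi>"] inv assms l by (simp add: permutes_inv_o)
  show "permute_list \<pi> xs \<in> tuples d n" "permute_list (Hilbert_Choice.inv \<pi>) xs \<in> tuples d n"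
    using xs inv assms by (simp_all add: tuples_def)
qed simp

lemma sum_lessThan_times:
  fixes f :: "nat \<Rightarrow> nat \<Rightarrow> 'a :: comm_monoid_add"
  shows "(\<Sum>i<m * n. f (i div n) (i mod n)) = (\<Sum>i<m. \<Sum>j<n. f i j)"
proof (induction m)
  case (Suc m)
  have "(\<Sum>i<Suc m * n. f (i div n) (i mod n)) =
      (\<Sum>i<m * n. f (i div n) (i mod n)) + (\<Sum>j<n. f ((j + m * n) div n) ((j + m * n) mod n))"
    using sum.atLeastLessThan_concat[of 0 "m * n" "Suc m * n" "\<lambda>i. f (i div n) (i mod n)"]
      sum.shift_bounds_nat_ivl[of "\<lambda>i. f (i div n) (i mod n)" 0 "m * n" n]
    by (simp add: atLeast0LessThan add.commute)
  also have "(\<Sum>j<n. f ((j + m * n) div n) ((j + m * n) mod n)) = (\<Sum>j<n. f m j)"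
    by (intro sum.cong) auto
  finally show ?case by (simp add: Suc.IH)
qed simp

section \<open>Clebsch-Gordan coefficients\<close>

text \<open>Values at complex points stand in for formal monomials in several variables;
  \<open>sum3_hmon_eq_0\<close> recovers the coefficients from the values.\<close>

definition hmon :: "nat \<Rightarrow> nat \<Rightarrow> complex \<Rightarrow> complex \<Rightarrow> complex" where
  "hmon n k x y = x ^ (n - k) * y ^ k"

lemma sum_hmon_eq_0:
  assumes "\<And>x y. (\<Sum>k\<le>n. c k * hmon n k x y) = 0" "k \<le> n"
  shows "c k = 0"
proof -
  have "\<forall>y. (\<Sum>k\<le>n. c k * y ^ k) = 0"
    using assms(1)[of 1] by (simp add: hmon_def)
  then show ?thesis using assms(2) by (simp only: polyfun_eq_0)
qed

lemma sum3_hmon_eq_0: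
  assumes "\<And>t0 t1 x0 x1 w0 w1. (\<Sum>m\<le>n. \<Sum>j\<le>a. \<Sum>l\<le>b.
      c m j l * hmon a j x0 x1 * hmon b l w0 w1 * hmon n m t0 t1) = 0"
    and "m \<le> n" "j \<le> a" "l \<le> b"
  shows "c m j l = 0"
proof -
  have "(\<Sum>j\<le>a. \<Sum>l\<le>b. c m j l * hmon a j x0 x1 * hmon b l w0 w1) = 0" for x0 x1 w0 w1
    by (rule sum_hmon_eq_0[OF _ assms(2)]) (use assms(1)[of x0 x1 w0 w1] in \<open>simp add: sum_distrib_right\<close>)
  then have "(\<Sum>l\<le>b. c m j l * hmon b l w0 w1) = 0" for w0 w1
    by (intro sum_hmon_eq_0[OF _ assms(3), where c = "\<lambda>j. \<Sum>l\<le>b. c m j l * hmon b l w0 w1"])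
      (simp add: sum_distrib_right sum_distrib_left mult_ac)
  then show ?thesis
    by (rule sum_hmon_eq_0[OF _ assms(4)])
qed

section \<open>Generating functions of rows and columns of the spin matrices\<close>

lemma sum_spin_poly_hmon:
  assumes "k \<le> n"
  shows "(\<Sum>j\<le>n. coeff (spin_poly n M k) j * hmon n j x y) =
    hmon n k (M $$ (0, 0) * x + M $$ (1, 0) * y) (M $$ (0, 1) * x + M $$ (1, 1) * y)"
proof -
  have "poly (hom_subst n (spin_poly n M k) [:x:] [:y:]) 0 =
      (\<Sum>j\<le>n. coeff (spin_poly n M k) j * hmon n j x y)"
    by (simp add: hom_subst_def poly_sum hmon_def)
  then show ?thesis
    unfolding hom_subst_spin_poly[OF assms] by (simp add: hmon_def)
qed

text \<open>Transposing M exchanges rows and columns up to a ratio of binomials, which is why a sum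
  over the column index needs the weights. Here M itself acts on (x, y), whereas the row sum in
  \<open>sum_spin_poly_hmon\<close> applies the transpose of M.\<close>

lemma sum_binomial_spin_poly_hmon:
  assumes "j \<le> n"
  shows "(\<Sum>k\<le>n. coeff (spin_poly n M k) j * (of_nat (n choose k) * hmon n k x y)) =
    of_nat (n choose j) *
    hmon n j (M $$ (0, 0) * x + M $$ (0, 1) * y) (M $$ (1, 0) * x + M $$ (1, 1) * y)"
proof -
  define N where "N = mat 2 2 (\<lambda>(i, j). M $$ (j, i))"
  have N: "N $$ (0, 0) = M $$ (0, 0)" "N $$ (0, 1) = M $$ (1, 0)"
    "N $$ (1, 0) = M $$ (0, 1)" "N $$ (1, 1) = M $$ (1, 1)"
    by (simp_all add: N_def)
  have "of_nat (n choose k) * coeff (spin_poly n M k) j = of_nat (n choose j) * coeff (spin_poly n N j) k"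
    if "k \<le> n" for k
    unfolding spin_poly_def N by (rule binomial_coeff_transpose[OF assms that])
  then have "(\<Sum>k\<le>n. coeff (spin_poly n M k) j * (of_nat (n choose k) * hmon n k x y)) =
      (\<Sum>k\<le>n. of_nat (n choose j) * (coeff (spin_poly n N j) k * hmon n k x y))"
    by (intro sum.cong refl) (simp, metis mult.assoc mult.commute)
  then show ?thesis
    using sum_spin_poly_hmon[OF assms, of N x y] by (simp only: sum_distrib_left[symmetric] N)
qed

text \<open>In the expansion of the trilinear form by three binomial theorems, i, j, k are the
  exponents of x1 w1, x1 t1 and - w1 t0. The exponents of t1, x1 and w1 are then j + (r - k), i + j
  and i + k, which have to be m, a and b.\<close>

definition tri_coeff :: "nat \<Rightarrow> nat \<Rightarrow> nat \<Rightarrow> nat \<Rightarrow> nat \<Rightarrow> nat \<Rightarrow> complex" where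
  "tri_coeff p q r m a b = (\<Sum>i\<le>q. \<Sum>j\<le>p. \<Sum>k\<le>r.
     if m = j + (r - k) \<and> a = i + j \<and> b = i + k
     then of_nat (q choose i) * of_nat (p choose j) * of_nat (r choose k) * (- 1) ^ k else 0)"

lemma sum3_delta:
  fixes c :: "'a :: comm_semiring_1"
  assumes "m0 \<le> (n :: nat)" "a0 \<le> (a' :: nat)" "b0 \<le> (b' :: nat)"
  shows "(\<Sum>m\<le>n. \<Sum>a\<le>a'. \<Sum>b\<le>b'. (if m = m0 \<and> a = a0 \<and> b = b0 then c else 0) * f m a b) =
    c * f m0 a0 b0"
proof -
  have "(if m = m0 \<and> a = a0 \<and> b = b0 then c else 0) * f m a b =
      (if m = m0 then if a = a0 then if b = b0 then c * f m a b else 0 else 0 else 0)" for m a b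
    by auto
  moreover have "(\<Sum>a\<le>a'. \<Sum>b\<le>b'. if m = m0 then if a = a0 then if b = b0 then c * f m a b else 0 else 0 else 0)
      = (if m = m0 then c * f m a0 b0 else 0)" for m
  proof (cases "m = m0")
    case True
    have "(\<Sum>b\<le>b'. if a = a0 then if b = b0 then c * f m a b else 0 else 0) =
      (if a = a0 then c * f m a b0 else 0)" for a
      using assms by (cases "a = a0") (simp_all add: sum.delta)
    with True assms show ?thesis by (simp add: sum.delta)
  qed simp
  ultimately show ?thesis using assms by (simp add: sum.delta)
qed

lemma sum_swap_1_2:
  fixes f :: "'a \<Rightarrow> 'b \<Rightarrow> 'c \<Rightarrow> 'g :: comm_monoid_add"
  shows "(\<Sum>a\<in>A. \<Sum>b\<in>B. \<Sum>c\<in>C. f a b c) = (\<Sum>b\<in>B. \<Sum>c\<in>C. \<Sum>a\<in>A. f a b c)"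
proof -
  have "(\<Sum>a\<in>A. \<Sum>c\<in>C. f a b c) = (\<Sum>c\<in>C. \<Sum>a\<in>A. f a b c)" for b
    by (rule sum.swap)
  then show ?thesis by (subst sum.swap) simp
qed

lemma sum_swap_2_2:
  fixes f :: "'a \<Rightarrow> 'b \<Rightarrow> 'c \<Rightarrow> 'd \<Rightarrow> 'g :: comm_monoid_add"
  shows "(\<Sum>a\<in>A. \<Sum>b\<in>B. \<Sum>c\<in>C. \<Sum>d\<in>D. f a b c d) =
    (\<Sum>c\<in>C. \<Sum>d\<in>D. \<Sum>a\<in>A. \<Sum>b\<in>B. f a b c d)"
proof -
  have "(\<Sum>b\<in>B. \<Sum>c\<in>C. \<Sum>d\<in>D. f a b c d) = (\<Sum>c\<in>C. \<Sum>d\<in>D. \<Sum>b\<in>B. f a b c d)" for a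
    by (rule sum_swap_1_2)
  then show ?thesis by (simp only:) (rule sum_swap_1_2)
qed

lemma sum_swap_3_3:
  fixes f :: "'a \<Rightarrow> 'b \<Rightarrow> 'c \<Rightarrow> 'd \<Rightarrow> 'e \<Rightarrow> 'f \<Rightarrow> 'g :: comm_monoid_add"
  shows "(\<Sum>a\<in>A. \<Sum>b\<in>B. \<Sum>c\<in>C. \<Sum>d\<in>D. \<Sum>e\<in>E. \<Sum>x\<in>X. f a b c d e x) =
    (\<Sum>d\<in>D. \<Sum>e\<in>E. \<Sum>x\<in>X. \<Sum>a\<in>A. \<Sum>b\<in>B. \<Sum>c\<in>C. f a b c d e x)"
proof -
  have swap: "(\<Sum>y\<in>Y. \<Sum>d\<in>D. \<Sum>e\<in>E. \<Sum>x\<in>X. g y d e x) =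
      (\<Sum>d\<in>D. \<Sum>e\<in>E. \<Sum>x\<in>X. \<Sum>y\<in>Y. g y d e x)" for Y :: "'y set" and g :: "'y \<Rightarrow> 'd \<Rightarrow> 'e \<Rightarrow> 'f \<Rightarrow> 'g"
    by (subst sum.swap) (simp only: sum_swap_1_2[of _ _ _ Y])
  show ?thesis by (simp only: swap[of _ C] swap[of _ B] swap[of _ A])
qed

lemma sum_tri_coeff:
  "(\<Sum>m\<le>p + r. \<Sum>a\<le>p + q. \<Sum>b\<le>q + r. tri_coeff p q r m a b *
      (hmon (p + q) a x0 x1 * hmon (q + r) b w0 w1 * hmon (p + r) m t0 t1)) =
    (x0 * w0 + x1 * w1) ^ q * (x0 * t0 + x1 * t1) ^ p * (w0 * t1 - w1 * t0) ^ r"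
proof -
  let ?h = "\<lambda>m a b. hmon (p + q) a x0 x1 * hmon (q + r) b w0 w1 * hmon (p + r) m t0 t1"
  let ?c = "\<lambda>i j k. of_nat (q choose i) * of_nat (p choose j) * of_nat (r choose k) * (- 1) ^ k :: complex"
  have "(\<Sum>m\<le>p + r. \<Sum>a\<le>p + q. \<Sum>b\<le>q + r. tri_coeff p q r m a b * ?h m a b) =
    (\<Sum>i\<le>q. \<Sum>j\<le>p. \<Sum>k\<le>r. \<Sum>m\<le>p + r. \<Sum>a\<le>p + q. \<Sum>b\<le>q + r.
      (if m = j + (r - k) \<and> a = i + j \<and> b = i + k then ?c i j k else 0) * ?h m a b)"
    unfolding tri_coeff_def sum_distrib_right by (rule sum_swap_3_3)
  also have "\<dots> = (\<Sum>i\<le>q. \<Sum>j\<le>p. \<Sum>k\<le>r. ?c i j k * ?h (j + (r - k)) (i + j) (i + k))"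
    by (intro sum.cong refl sum3_delta) auto
  also have "\<dots> = (\<Sum>i\<le>q. \<Sum>j\<le>p. \<Sum>k\<le>r.
      (of_nat (q choose i) * (x1 * w1) ^ i * (x0 * w0) ^ (q - i)) *
      (of_nat (p choose j) * (x1 * t1) ^ j * (x0 * t0) ^ (p - j)) *
      (of_nat (r choose k) * (- (w1 * t0)) ^ k * (w0 * t1) ^ (r - k)))"
  proof (intro sum.cong refl)
    fix i j k assume "i \<in> {..q}" "j \<in> {..p}" "k \<in> {..r}"
    \<comment> \<open>Exponents of x0, w0 and t0; because of the truncated subtraction they split
      like this only for i, j, k within their ranges.\<close>
    then have e: "p + q - (i + j) = (q - i) + (p - j)" "q + r - (i + k) = (q - i) + (r - k)"
      "p + r - (j + (r - k)) = (p - j) + k" by auto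
    have "(- (w1 * t0)) ^ k = (- 1) ^ k * (w1 ^ k * t0 ^ k)"
      by (metis mult_minus1 power_mult_distrib)
    then show "?c i j k * ?h (j + (r - k)) (i + j) (i + k) =
      (of_nat (q choose i) * (x1 * w1) ^ i * (x0 * w0) ^ (q - i)) *
      (of_nat (p choose j) * (x1 * t1) ^ j * (x0 * t0) ^ (p - j)) *
      (of_nat (r choose k) * (- (w1 * t0)) ^ k * (w0 * t1) ^ (r - k))"
      by (simp only: hmon_def e power_add power_mult_distrib mult_ac)
  qed
  also have "\<dots> = (x1 * w1 + x0 * w0) ^ q * (x1 * t1 + x0 * t0) ^ p * (- (w1 * t0) + w0 * t1) ^ r"
    unfolding binomial_ring
    by (simp only: sum_distrib_left sum_distrib_right mult.assoc sum.swap[of _ "{..q}"])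
       (subst sum.swap, simp only: mult_ac)
  finally show ?thesis by (simp add: add.commute)
qed

text \<open>The variables w and t will be attached to column indices, whose sums carry binomial
  weights; dividing by these weights in advance keeps the generating function equal to the trilinear
  form. The variable x is attached to a row index and carries no weight.\<close>

definition cg0 :: "nat \<Rightarrow> nat \<Rightarrow> nat \<Rightarrow> nat \<Rightarrow> nat \<Rightarrow> nat \<Rightarrow> complex" where
  "cg0 p q r m a b = tri_coeff p q r m a b / (of_nat ((q + r) choose b) * of_nat ((p + r) choose m))"

lemma sum_cg0:
  "(\<Sum>m\<le>p + r. \<Sum>a\<le>p + q. \<Sum>b\<le>q + r. cg0 p q r m a b *
     (hmon (p + q) a x0 x1 * (of_nat ((q + r) choose b) * hmon (q + r) b w0 w1) *
      (of_nat ((p + r) choose m) * hmon (p + r) m t0 t1))) =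
    (x0 * w0 + x1 * w1) ^ q * (x0 * t0 + x1 * t1) ^ p * (w0 * t1 - w1 * t0) ^ r"
  unfolding sum_tri_coeff[symmetric]
  by (intro sum.cong refl) (simp add: cg0_def)

text \<open>The intertwining property in the monomial basis: M' is the adjugate of M, hence its
  inverse, and the component k is transformed like a symmetric spinor of degree p + r.\<close>

lemma cg0_covariant:
  assumes det: "M $$ (0, 0) * M $$ (1, 1) - M $$ (0, 1) * M $$ (1, 0) = 1"
    and inv: "M' $$ (0, 0) = M $$ (1, 1)" "M' $$ (0, 1) = - M $$ (0, 1)"
      "M' $$ (1, 0) = - M $$ (1, 0)" "M' $$ (1, 1) = M $$ (0, 0)"
    and "k \<le> p + r" "j \<le> p + q" "l \<le> q + r"
  shows "(\<Sum>a\<le>p + q. \<Sum>b\<le>q + r. coeff (spin_poly (p + q) M a) j * cg0 p q r k a b *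
      coeff (spin_poly (q + r) M' l) b) =
    (\<Sum>m\<le>p + r. coeff (spin_poly (p + r) M k) m * cg0 p q r m j l)"
proof -
  define L where "L k j l = (\<Sum>a\<le>p + q. \<Sum>b\<le>q + r. coeff (spin_poly (p + q) M a) j *
    cg0 p q r k a b * coeff (spin_poly (q + r) M' l) b)" for k j l
  define R where "R k j l = (\<Sum>m\<le>p + r. coeff (spin_poly (p + r) M k) m * cg0 p q r m j l)" for k j l
  define C where "C k l = (of_nat ((q + r) choose l) * of_nat ((p + r) choose k) :: complex)" for k l
  (* Both sides are coefficients of the trilinear form: of its value at (M^T x, t, M' w) on the left,
     and at (x, M t, w) on the right. *)
  have "C k l * (L k j l - R k j l) = 0"
  proof (rule sum3_hmon_eq_0[OF _ assms(6-8)])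
    fix t0 t1 x0 x1 w0 w1
    let ?x = "\<lambda>j. hmon (p + q) j x0 x1"
    let ?w = "\<lambda>l. of_nat ((q + r) choose l) * hmon (q + r) l w0 w1"
    let ?t = "\<lambda>k. of_nat ((p + r) choose k) * hmon (p + r) k t0 t1"
    have "(\<Sum>k\<le>p + r. \<Sum>j\<le>p + q. \<Sum>l\<le>q + r. L k j l * (?x j * ?w l * ?t k)) =
      (\<Sum>k\<le>p + r. \<Sum>a\<le>p + q. \<Sum>b\<le>q + r. cg0 p q r k a b *
        ((\<Sum>j\<le>p + q. coeff (spin_poly (p + q) M a) j * ?x j) *
         (\<Sum>l\<le>q + r. coeff (spin_poly (q + r) M' l) b * ?w l) * ?t k))"
    proof (rule sum.cong[OF refl])
      fix k
      have "(\<Sum>j\<le>p + q. \<Sum>l\<le>q + r. L k j l * (?x j * ?w l * ?t k)) =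
        (\<Sum>a\<le>p + q. \<Sum>b\<le>q + r. \<Sum>j\<le>p + q. \<Sum>l\<le>q + r. coeff (spin_poly (p + q) M a) j *
          cg0 p q r k a b * coeff (spin_poly (q + r) M' l) b * (?x j * ?w l * ?t k))"
        unfolding L_def sum_distrib_right by (rule sum_swap_2_2)
      also have "\<dots> = (\<Sum>a\<le>p + q. \<Sum>b\<le>q + r. cg0 p q r k a b *
        ((\<Sum>j\<le>p + q. coeff (spin_poly (p + q) M a) j * ?x j) *
         (\<Sum>l\<le>q + r. coeff (spin_poly (q + r) M' l) b * ?w l) * ?t k))"
        by (intro sum.cong refl, simp only: sum_product, simp only: sum_distrib_left sum_distrib_right)
          (intro sum.cong refl, simp only: mult_ac)
      finally show "(\<Sum>j\<le>p + q. \<Sum>l\<le>q + r. L k j l * (?x j * ?w l * ?t k)) = \<dots>" .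
    qed
    also have "\<dots> = (\<Sum>k\<le>p + r. \<Sum>a\<le>p + q. \<Sum>b\<le>q + r. cg0 p q r k a b *
       (hmon (p + q) a (M $$ (0, 0) * x0 + M $$ (1, 0) * x1) (M $$ (0, 1) * x0 + M $$ (1, 1) * x1) *
       (of_nat ((q + r) choose b) *
        hmon (q + r) b (M' $$ (0, 0) * w0 + M' $$ (0, 1) * w1) (M' $$ (1, 0) * w0 + M' $$ (1, 1) * w1)) * ?t k))"
      by (intro sum.cong refl) (simp only: sum_spin_poly_hmon sum_binomial_spin_poly_hmon atMost_iff)
    also have "\<dots> = (x0 * w0 + x1 * w1) ^ q *
        (x0 * (M $$ (0, 0) * t0 + M $$ (0, 1) * t1) + x1 * (M $$ (1, 0) * t0 + M $$ (1, 1) * t1)) ^ p *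
        (w0 * (M $$ (1, 0) * t0 + M $$ (1, 1) * t1) - w1 * (M $$ (0, 0) * t0 + M $$ (0, 1) * t1)) ^ r"
    proof -
      \<comment> \<open>The pairing of M^T x with M' w is det M times x . w. In the other two
        factors, expansion moves M from x and from w onto t.\<close>
      have *: "(M00 * x0 + M10 * x1) * (M11 * w0 + - M01 * w1) + (M01 * x0 + M11 * x1) * (- M10 * w0 + M00 * w1) =
          (M00 * M11 - M01 * M10) * (x0 * w0 + x1 * w1)" for M00 M01 M10 M11 :: complex
        by (simp add: algebra_simps)
      show ?thesis
        unfolding sum_cg0 inv * det
        by (simp add: algebra_simps)
    qed
    also have "\<dots> = (\<Sum>m\<le>p + r. \<Sum>j\<le>p + q. \<Sum>l\<le>q + r. cg0 p q r m j l * (?x j * ?w l *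
        (of_nat ((p + r) choose m) *
         hmon (p + r) m (M $$ (0, 0) * t0 + M $$ (0, 1) * t1) (M $$ (1, 0) * t0 + M $$ (1, 1) * t1))))"
      by (simp only: sum_cg0)
    also have "\<dots> = (\<Sum>m\<le>p + r. \<Sum>j\<le>p + q. \<Sum>l\<le>q + r. \<Sum>k\<le>p + r.
        coeff (spin_poly (p + r) M k) m * cg0 p q r m j l * (?x j * ?w l * ?t k))"
      by (intro sum.cong refl, simp only: sum_binomial_spin_poly_hmon[symmetric] atMost_iff sum_distrib_left)
        (intro sum.cong refl, simp only: mult_ac)
    also have "\<dots> = (\<Sum>m\<le>p + r. \<Sum>k\<le>p + r. \<Sum>j\<le>p + q. \<Sum>l\<le>q + r.
        coeff (spin_poly (p + r) M k) m * cg0 p q r m j l * (?x j * ?w l * ?t k))"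
      by (rule sum.cong[OF refl]) (rule sum_swap_1_2[symmetric])
    also have "\<dots> = (\<Sum>k\<le>p + r. \<Sum>m\<le>p + r. \<Sum>j\<le>p + q. \<Sum>l\<le>q + r.
        coeff (spin_poly (p + r) M k) m * cg0 p q r m j l * (?x j * ?w l * ?t k))"
      by (rule sum.swap)
    also have "\<dots> = (\<Sum>k\<le>p + r. \<Sum>j\<le>p + q. \<Sum>l\<le>q + r. R k j l * (?x j * ?w l * ?t k))"
      unfolding R_def sum_distrib_right
      by (rule sum.cong[OF refl]) (rule sum_swap_1_2)
    finally have "(\<Sum>k\<le>p + r. \<Sum>j\<le>p + q. \<Sum>l\<le>q + r. L k j l * (?x j * ?w l * ?t k)) =
      (\<Sum>k\<le>p + r. \<Sum>j\<le>p + q. \<Sum>l\<le>q + r. R k j l * (?x j * ?w l * ?t k))" .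
    then have "(\<Sum>k\<le>p + r. \<Sum>j\<le>p + q. \<Sum>l\<le>q + r. (L k j l - R k j l) * (?x j * ?w l * ?t k)) = 0"
      by (simp only: left_diff_distrib sum_subtractf diff_self)
    then show "(\<Sum>k\<le>p + r. \<Sum>j\<le>p + q. \<Sum>l\<le>q + r. C k l * (L k j l - R k j l) *
        hmon (p + q) j x0 x1 * hmon (q + r) l w0 w1 * hmon (p + r) k t0 t1) = 0"
      by (simp only: C_def mult_ac)
  qed
  moreover have "C k l \<noteq> 0" using assms(6-8) by (simp add: C_def)
  ultimately show ?thesis by (simp add: L_def R_def)
qed

(* The square roots pass from monomials to the normalised basis of spin_rep. *)
definition cg :: "nat \<Rightarrow> nat \<Rightarrow> nat \<Rightarrow> nat \<Rightarrow> nat \<Rightarrow> nat \<Rightarrow> complex" where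
  "cg p q r m a b = complex_of_real (sqrt (real ((q + r) choose b)) / sqrt (real ((p + q) choose a))) *
     cg0 p q r m a b"

text \<open>The square roots at the summation indices a and b cancel between \<open>cg\<close> and
  the two spin matrices, leaving a common factor that depends on j and l only. The index k stays
  unnormalised, since it will be contracted with spinor tuples and not with a
  \<open>spin_rep\<close>.\<close>

lemma cg_covariant:
  assumes "M $$ (0, 0) * M $$ (1, 1) - M $$ (0, 1) * M $$ (1, 0) = 1"
    and "M' $$ (0, 0) = M $$ (1, 1)" "M' $$ (0, 1) = - M $$ (0, 1)"
      "M' $$ (1, 0) = - M $$ (1, 0)" "M' $$ (1, 1) = M $$ (0, 0)"
    and "twice s = p + q" "twice s' = q + r"
    and k: "k \<le> p + r" and j: "j \<le> p + q" and l: "l \<le> q + r"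
  shows "(\<Sum>a\<le>p + q. \<Sum>b\<le>q + r. spin_rep s M $$ (j, a) * cg p q r k a b * spin_rep s' M' $$ (b, l)) =
    (\<Sum>m\<le>p + r. coeff (spin_poly (p + r) M k) m * cg p q r m j l)"
proof -
  define S where "S = (\<lambda>n k. complex_of_real (sqrt (real (n choose k))))"
  have "(\<Sum>a\<le>p + q. \<Sum>b\<le>q + r. spin_rep s M $$ (j, a) * cg p q r k a b * spin_rep s' M' $$ (b, l)) =
    (\<Sum>a\<le>p + q. \<Sum>b\<le>q + r. (S (q + r) l / S (p + q) j) * (coeff (spin_poly (p + q) M a) j * cg0 p q r k a b *
      coeff (spin_poly (q + r) M' l) b))"
    by (intro sum.cong refl)
      (use j l in \<open>auto simp: spin_rep_index assms(6,7) cg_def S_def\<close>)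
  also have "\<dots> = (S (q + r) l / S (p + q) j) * (\<Sum>m\<le>p + r. coeff (spin_poly (p + r) M k) m * cg0 p q r m j l)"
    unfolding cg0_covariant[OF assms(1-5) k j l, symmetric] by (simp only: sum_distrib_left)
  also have "\<dots> = (\<Sum>m\<le>p + r. coeff (spin_poly (p + r) M k) m * cg p q r m j l)"
    unfolding sum_distrib_left by (intro sum.cong refl) (simp add: cg_def S_def)
  finally show ?thesis .
qed

text \<open>The trilinear form at x = w = (1, 0) and t = (1, 1), where each of its three factors is
  1. This choice of x and w isolates the component a = b = 0.\<close>

lemma sum_binomial_cg: "(\<Sum>m\<le>p + r. of_nat ((p + r) choose m) * cg p q r m 0 0) = 1"
proof -
  have 0: "hmon n a 1 0 = (if a = 0 then 1 else 0)" for n a by (simp add: hmon_def)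
  have 1: "hmon n a 1 1 = 1" for n a by (simp add: hmon_def)
  have "(\<Sum>m\<le>p + r. of_nat ((p + r) choose m) * cg p q r m 0 0) =
    (\<Sum>m\<le>p + r. \<Sum>a\<le>p + q. \<Sum>b\<le>q + r. cg0 p q r m a b *
      (hmon (p + q) a 1 0 * (of_nat ((q + r) choose b) * hmon (q + r) b 1 0) *
      (of_nat ((p + r) choose m) * hmon (p + r) m 1 1)))"
  proof (rule sum.cong[OF refl])
    fix m
    have "(\<Sum>b\<le>q + r. cg0 p q r m a b *
        (hmon (p + q) a 1 0 * (of_nat ((q + r) choose b) * hmon (q + r) b 1 0) *
        (of_nat ((p + r) choose m) * hmon (p + r) m 1 1))) =
      (\<Sum>b\<le>q + r. if b = 0 then if a = 0 then of_nat ((p + r) choose m) * cg p q r m 0 0 else 0 else 0)" for a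
      by (intro sum.cong refl) (simp add: 0 1 cg_def)
    then show "of_nat ((p + r) choose m) * cg p q r m 0 0 =
      (\<Sum>a\<le>p + q. \<Sum>b\<le>q + r. cg0 p q r m a b *
        (hmon (p + q) a 1 0 * (of_nat ((q + r) choose b) * hmon (q + r) b 1 0) *
        (of_nat ((p + r) choose m) * hmon (p + r) m 1 1)))"
      by (simp add: sum.delta)
  qed
  then show ?thesis by (simp only: sum_cg0) simp
qed

section \<open>From spinors to tensors\<close>

(* g_{mu mu} X(e_mu) eps with eps = ((0, 1), (-1, 0)).  Since eps N^T = M^dagger eps for
   N = (M^dagger)^(-1) and det M = 1, the second index transforms with N. *)
definition soldering :: "nat \<Rightarrow> nat \<Rightarrow> nat \<Rightarrow> complex" where
  "soldering \<mu> a b = complex_of_real (minkowski \<mu> \<mu>) *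
     (if b = 0 then - momentum_mat (unit_vec 4 \<mu>) $$ (a, 1) else momentum_mat (unit_vec 4 \<mu>) $$ (a, 0))"

(* A totally symmetric spinor component depends only on the number of ones among its indices
   in {0, 1}, which is their sum; G holds the components by these numbers. *)
definition spinor_sum :: "nat \<Rightarrow> (nat \<Rightarrow> nat \<Rightarrow> complex) \<Rightarrow> nat list \<Rightarrow> complex" where
  "spinor_sum n G \<mu> = (\<Sum>x\<in>tuples 2 n. \<Sum>y\<in>tuples 2 n.
     (\<Prod>h<n. soldering (\<mu> ! h) (x ! h) (y ! h)) * G (sum_list x) (sum_list y))"

text \<open>A permutation of the vector indices is absorbed by permuting both spinor tuples in the
  same way, and \<open>G\<close> sees only their sums; no symmetrisation is required.\<close>

lemma spinor_sum_permute:
  assumes \<pi>: "\<pi> permutes {..<n}" and \<mu>: "length \<mu> = n"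
  shows "spinor_sum n G (permute_list \<pi> \<mu>) = spinor_sum n G \<mu>"
proof -
  define f where "f \<mu> x y = (\<Prod>h<n. soldering (\<mu> ! h) (x ! h) (y ! h)) * G (sum_list x) (sum_list y)" for \<mu> x y
  have f: "f (permute_list \<pi> \<mu>) (permute_list \<pi> x) (permute_list \<pi> y) = f \<mu> x y"
    if "x \<in> tuples 2 n" "y \<in> tuples 2 n" for x y
  proof -
    have l: "length x = n" "length y = n" using that by (simp_all add: tuples_def)
    have "sum_list (permute_list \<pi> z) = sum_list z" if "length z = n" for z :: "nat list"
      using \<pi> that by (metis mset_permute_list sum_mset_sum_list)
    moreover have "(\<Prod>h<n. soldering (permute_list \<pi> \<mu> ! h) (permute_list \<pi> x ! h) (permute_list \<pi> y ! h)) =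
        (\<Prod>h<n. soldering (\<mu> ! \<pi> h) (x ! \<pi> h) (y ! \<pi> h))"
      using l \<mu> \<pi> by (intro prod.cong refl) (simp add: permute_list_nth)
    moreover have "\<dots> = (\<Prod>h<n. soldering (\<mu> ! h) (x ! h) (y ! h))"
      using prod.permute[OF \<pi>, of "\<lambda>h. soldering (\<mu> ! h) (x ! h) (y ! h)"] by (simp add: o_def)
    ultimately show ?thesis by (simp add: f_def l)
  qed
  have "spinor_sum n G (permute_list \<pi> \<mu>) =
      (\<Sum>x\<in>tuples 2 n. \<Sum>y\<in>tuples 2 n. f (permute_list \<pi> \<mu>) (permute_list \<pi> x) (permute_list \<pi> y))"
    unfolding spinor_sum_def f_def[symmetric]
    by (simp only: sum_permute_tuples[OF \<pi>, where f = "f (permute_list \<pi> \<mu>) _"]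
      sum_permute_tuples[OF \<pi>, where f = "\<lambda>x. \<Sum>y\<in>tuples 2 n. f (permute_list \<pi> \<mu>) x y"])
  also have "\<dots> = spinor_sum n G \<mu>"
    unfolding spinor_sum_def f_def[symmetric] by (intro sum.cong refl f)
  finally show ?thesis .
qed

lemma spinor_sum_Cons:
  "spinor_sum (Suc n) G (\<alpha> # \<mu>) =
    (\<Sum>a<2. \<Sum>b<2. soldering \<alpha> a b * spinor_sum n (\<lambda>x y. G (a + x) (b + y)) \<mu>)"
proof -
  have "spinor_sum (Suc n) G (\<alpha> # \<mu>) = (\<Sum>a<2. \<Sum>x\<in>tuples 2 n. \<Sum>b<2. \<Sum>y\<in>tuples 2 n.
    soldering \<alpha> a b * ((\<Prod>h<n. soldering (\<mu> ! h) (x ! h) (y ! h)) * G (a + sum_list x) (b + sum_list y)))"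
    by (simp only: spinor_sum_def sum_tuples_Suc prod.lessThan_Suc_shift nth_Cons_0 nth_Cons_Suc
      sum_list.Cons mult.assoc)
  also have "\<dots> = (\<Sum>a<2. \<Sum>b<2. \<Sum>x\<in>tuples 2 n. \<Sum>y\<in>tuples 2 n.
    soldering \<alpha> a b * ((\<Prod>h<n. soldering (\<mu> ! h) (x ! h) (y ! h)) * G (a + sum_list x) (b + sum_list y)))"
    by (rule sum.cong[OF refl]) (rule sum.swap)
  finally show ?thesis
    by (simp only: spinor_sum_def sum_distrib_left)
qed

lemma soldering_values:
  "soldering 0 0 0 = 0" "soldering 0 0 (Suc 0) = - 1"
  "soldering 0 (Suc 0) 0 = 1" "soldering 0 (Suc 0) (Suc 0) = 0"
  "soldering (Suc 0) 0 0 = 1" "soldering (Suc 0) 0 (Suc 0) = 0"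
  "soldering (Suc 0) (Suc 0) 0 = 0" "soldering (Suc 0) (Suc 0) (Suc 0) = - 1"
  "soldering (Suc (Suc 0)) 0 0 = - \<i>" "soldering (Suc (Suc 0)) 0 (Suc 0) = 0"
  "soldering (Suc (Suc 0)) (Suc 0) 0 = 0" "soldering (Suc (Suc 0)) (Suc 0) (Suc 0) = - \<i>"
  "soldering (Suc (Suc (Suc 0))) 0 0 = 0" "soldering (Suc (Suc (Suc 0))) 0 (Suc 0) = - 1"
  "soldering (Suc (Suc (Suc 0))) (Suc 0) 0 = - 1" "soldering (Suc (Suc (Suc 0))) (Suc 0) (Suc 0) = 0"
  by (simp_all add: soldering_def momentum_mat_index minkowski_def numeral_eq_Suc)

text \<open>Contracting two soldering matrices with indices (a, b) and (c, d) by the metric gives -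
  2 eps_ac eps_bd. This is antisymmetric in a, c, while \<open>G\<close> depends on a and c only
  through a + c, so the terms cancel.\<close>

lemma spinor_sum_traceless:
  "(\<Sum>\<alpha><4. \<Sum>\<beta><4. complex_of_real (minkowski \<alpha> \<beta>) * spinor_sum (Suc (Suc n)) G (\<alpha> # \<beta> # \<mu>)) = 0"
  unfolding spinor_sum_Cons
  by (simp add: numeral_eq_Suc soldering_values minkowski_def) (simp add: algebra_simps)

lemma sum_prod_tuples_tuples:
  fixes f :: "nat \<Rightarrow> nat \<Rightarrow> nat \<Rightarrow> 'a :: comm_semiring_1"
  shows "(\<Sum>x\<in>tuples d n. \<Sum>y\<in>tuples d n. \<Prod>h<n. f h (x ! h) (y ! h)) =
    (\<Prod>h<n. \<Sum>a<d. \<Sum>b<d. f h a b)"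
  by (simp only: sum_prod_tuples[where f = "\<lambda>h. f h (_ ! h)"]
    sum_prod_tuples[where f = "\<lambda>h a. \<Sum>b<d. f h a b"])

text \<open>Weights that are products over the slots can be contracted slot by slot. Covariance uses
  this with Lorentz matrices as weights, nonvanishing with a fixed complex vector.\<close>

lemma sum_prod_spinor_sum:
  "(\<Sum>\<mu>\<in>tuples 4 n. (\<Prod>h<n. c h (\<mu> ! h)) * spinor_sum n G \<mu>) =
    (\<Sum>x\<in>tuples 2 n. \<Sum>y\<in>tuples 2 n.
      (\<Prod>h<n. \<Sum>\<alpha><4. c h \<alpha> * soldering \<alpha> (x ! h) (y ! h)) * G (sum_list x) (sum_list y))"
proof -
  have "(\<Sum>\<mu>\<in>tuples 4 n. (\<Prod>h<n. c h (\<mu> ! h)) * spinor_sum n G \<mu>) =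
    (\<Sum>\<mu>\<in>tuples 4 n. \<Sum>x\<in>tuples 2 n. \<Sum>y\<in>tuples 2 n.
      (\<Prod>h<n. c h (\<mu> ! h) * soldering (\<mu> ! h) (x ! h) (y ! h)) * G (sum_list x) (sum_list y))"
    by (simp only: spinor_sum_def sum_distrib_left prod.distrib mult.assoc)
  also have "\<dots> = (\<Sum>x\<in>tuples 2 n. \<Sum>y\<in>tuples 2 n. \<Sum>\<mu>\<in>tuples 4 n.
      (\<Prod>h<n. c h (\<mu> ! h) * soldering (\<mu> ! h) (x ! h) (y ! h)) * G (sum_list x) (sum_list y))"
    by (rule sum_swap_1_2)
  also have "\<dots> = (\<Sum>x\<in>tuples 2 n. \<Sum>y\<in>tuples 2 n.
      (\<Prod>h<n. \<Sum>\<alpha><4. c h \<alpha> * soldering \<alpha> (x ! h) (y ! h)) * G (sum_list x) (sum_list y))"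
    by (simp only: sum_distrib_right[symmetric]
      sum_prod_tuples[where f = "\<lambda>h \<alpha>. c h \<alpha> * soldering \<alpha> (_ ! h) (_ ! h)"])
  finally show ?thesis .
qed

text \<open>The symmetric power is a restriction of the tensor power: acting on a symmetric
  component amounts to acting with M on every slot of a tuple.\<close>

lemma sum_coeff_spin_poly:
  assumes "x \<in> tuples 2 n"
  shows "(\<Sum>m\<le>n. coeff (spin_poly n M (sum_list x)) m * g m) =
    (\<Sum>x'\<in>tuples 2 n. (\<Prod>h<n. M $$ (x' ! h, x ! h)) * g (sum_list x'))"
  using sum_prod_tuples_2[where n = n and f = "\<lambda>h a. M $$ (a, x ! h)" and g = g] by (simp add: spin_poly_prod[OF assms, symmetric])

text \<open>The action on \<open>G\<close> is moved onto the soldering matrices, one factor M and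
  one factor N for each slot, which reduces covariance to that of a single vector index.\<close>

lemma spinor_sum_transform:
  "spinor_sum n (\<lambda>a b. \<Sum>m\<le>n. \<Sum>m'\<le>n. coeff (spin_poly n M a) m * coeff (spin_poly n N b) m' * G m m') \<mu> =
    (\<Sum>x\<in>tuples 2 n. \<Sum>y\<in>tuples 2 n.
      (\<Prod>h<n. \<Sum>a<2. \<Sum>b<2. soldering (\<mu> ! h) a b * (M $$ (x ! h, a) * N $$ (y ! h, b))) *
      G (sum_list x) (sum_list y))"
proof -
  have "spinor_sum n (\<lambda>a b. \<Sum>m\<le>n. \<Sum>m'\<le>n. coeff (spin_poly n M a) m * coeff (spin_poly n N b) m' * G m m') \<mu> =
    (\<Sum>x\<in>tuples 2 n. \<Sum>y\<in>tuples 2 n. (\<Prod>h<n. soldering (\<mu> ! h) (x ! h) (y ! h)) *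
      (\<Sum>x'\<in>tuples 2 n. (\<Prod>h<n. M $$ (x' ! h, x ! h)) *
        (\<Sum>y'\<in>tuples 2 n. (\<Prod>h<n. N $$ (y' ! h, y ! h)) * G (sum_list x') (sum_list y'))))"
    unfolding spinor_sum_def mult.assoc
    by (intro sum.cong refl arg_cong2[where f = "(*)"])
      (simp only: sum_distrib_left[symmetric] sum_coeff_spin_poly)
  also have "\<dots> = (\<Sum>x\<in>tuples 2 n. \<Sum>y\<in>tuples 2 n. \<Sum>x'\<in>tuples 2 n. \<Sum>y'\<in>tuples 2 n.
      (\<Prod>h<n. soldering (\<mu> ! h) (x ! h) (y ! h) * (M $$ (x' ! h, x ! h) * N $$ (y' ! h, y ! h))) *
      G (sum_list x') (sum_list y'))"
    by (simp only: sum_distrib_left prod.distrib mult.assoc)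
  also have "\<dots> = (\<Sum>x'\<in>tuples 2 n. \<Sum>y'\<in>tuples 2 n. \<Sum>x\<in>tuples 2 n. \<Sum>y\<in>tuples 2 n.
      (\<Prod>h<n. soldering (\<mu> ! h) (x ! h) (y ! h) * (M $$ (x' ! h, x ! h) * N $$ (y' ! h, y ! h))) *
      G (sum_list x') (sum_list y'))"
    by (rule sum_swap_2_2)
  also have "\<dots> = (\<Sum>x'\<in>tuples 2 n. \<Sum>y'\<in>tuples 2 n.
      (\<Prod>h<n. \<Sum>a<2. \<Sum>b<2. soldering (\<mu> ! h) a b * (M $$ (x' ! h, a) * N $$ (y' ! h, b))) *
      G (sum_list x') (sum_list y'))"
    by (simp only: sum_distrib_right[symmetric]
      sum_prod_tuples_tuples[where f = "\<lambda>h a b. soldering (\<mu> ! h) a b * (M $$ (_ ! h, a) * N $$ (_ ! h, b))"])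
  finally show ?thesis .
qed

(* The inverse of the adjoint of M, provided that det M = 1 *)
definition adj_inv :: "complex mat \<Rightarrow> complex mat" where
  "adj_inv M = mat 2 2 (\<lambda>(i, j). if i = j then cnj (M $$ (1 - i, 1 - j)) else - cnj (M $$ (j, i)))"

lemma adj_inv_carrier [simp]: "adj_inv M \<in> carrier_mat 2 2"
  by (simp add: adj_inv_def)

lemma adj_inv_index:
  "adj_inv M $$ (0, 0) = cnj (M $$ (1, 1))" "adj_inv M $$ (0, 1) = - cnj (M $$ (1, 0))"
  "adj_inv M $$ (1, 0) = - cnj (M $$ (0, 1))" "adj_inv M $$ (1, 1) = cnj (M $$ (0, 0))"
  by (simp_all add: adj_inv_def)

section \<open>Covariance of a single vector index\<close>

lemma SL2C_D:
  assumes "M \<in> SL2C"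
  shows "M \<in> carrier_mat 2 2" "M $$ (0, 0) * M $$ (1, 1) - M $$ (0, 1) * M $$ (1, 0) = 1"
proof -
  show M: "M \<in> carrier_mat 2 2" using assms by (simp add: SL2C_def)
  have "det M = (\<Sum>i<2. M $$ (i, 0) * cofactor M i 0)"
    by (rule laplace_expansion_column[OF M]) simp
  also have "\<dots> = M $$ (0, 0) * M $$ (1, 1) - M $$ (0, 1) * M $$ (1, 0)"
    using M by (simp add: numeral_2_eq_2 cofactor_def det_single mat_delete_def)
  finally show "M $$ (0, 0) * M $$ (1, 1) - M $$ (0, 1) * M $$ (1, 0) = 1"
    using assms by (simp add: SL2C_def)
qed

text \<open>The explicit inverse makes the adjoint a unit of the matrix ring, which excludes the
  result \<open>None\<close>; uniqueness of inverses then determines the value.\<close>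

lemma mat_inverse_mat_adjoint:
  assumes "M \<in> SL2C"
  shows "mat_inverse (mat_adjoint M) = Some (adj_inv M)"
proof -
  note M = SL2C_D[OF assms]
  let ?M = "mat_adjoint M" and ?N = "adj_inv M"
  have Mc: "?M \<in> carrier_mat 2 2" using M by simp
  have "cnj (M $$ (0, 0) * M $$ (1, 1) - M $$ (0, 1) * M $$ (1, 0)) = 1" by (simp only: M) simp
  then have det: "cnj (M $$ (0, 0)) * cnj (M $$ (1, 1)) = 1 + cnj (M $$ (0, 1)) * cnj (M $$ (1, 0))"
    by (simp add: algebra_simps)
  have 1: "?M * ?N = 1\<^sub>m 2" "?N * ?M = 1\<^sub>m 2"
    using det Mc M(1)
    by (auto intro!: mat2_eqI mult_carrier_mat[of _ 2 2] simp: mat2_mult_index[OF Mc] mat2_mult_index[OF _ Mc]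
      mat_adjoint_index[OF M(1)] adj_inv_index[simplified] algebra_simps)
  then have "?M \<in> Units (ring_mat TYPE(complex) 2 ())"
    unfolding Units_def using Mc by (auto simp: ring_mat_simps intro!: bexI[of _ ?N])
  then obtain B where B: "mat_inverse ?M = Some B"
    using mat_inverse(1)[OF Mc, where b = "()"] by (cases "mat_inverse ?M") auto
  then have "?M * B = 1\<^sub>m 2" "B \<in> carrier_mat 2 2" using mat_inverse(2)[OF Mc] by auto
  then have "B = ?N"
    using 1(2) Mc by (metis adj_inv_carrier assoc_mult_mat left_mult_one_mat right_mult_one_mat)
  then show ?thesis using B by simp
qed

lemma momentum_mat_sum:
  assumes "L \<in> carrier_mat 4 4" "\<mu> < 4" "i < 2" "j < 2"
  shows "momentum_mat (L *\<^sub>v unit_vec 4 \<mu>) $$ (i, j) =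
    (\<Sum>\<nu><4. complex_of_real (L $$ (\<nu>, \<mu>)) * momentum_mat (unit_vec 4 \<nu>) $$ (i, j))"
proof -
  have "(L *\<^sub>v unit_vec 4 \<mu>) $ \<nu> = L $$ (\<nu>, \<mu>)" if "\<nu> < 4" for \<nu>
    using that assms by simp
  then have *: "(L *\<^sub>v unit_vec 4 \<mu>) $ 0 = L $$ (0, \<mu>)" "(L *\<^sub>v unit_vec 4 \<mu>) $ Suc 0 = L $$ (Suc 0, \<mu>)"
    "(L *\<^sub>v unit_vec 4 \<mu>) $ 2 = L $$ (2, \<mu>)" "(L *\<^sub>v unit_vec 4 \<mu>) $ 3 = L $$ (3, \<mu>)"
    by simp_all
  have sum4: "(\<Sum>\<nu><4. f \<nu>) = f 0 + f (Suc 0) + f 2 + f 3" for f :: "nat \<Rightarrow> complex"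
    by (simp add: numeral_eq_Suc)
  consider "i = 0" "j = 0" | "i = 0" "j = Suc 0" | "i = Suc 0" "j = 0" | "i = Suc 0" "j = Suc 0"
    using assms(3,4) by linarith
  then show ?thesis
    by cases (simp_all only: sum4 momentum_mat_index One_nat_def *, simp_all)
qed

text \<open>The covering relation at the basis vector e_\<mu> is multiplied by eps from the right,
  with M^dagger eps = eps N^T. Lowering and raising gives g_\<nu>\<nu> g_\<mu>\<mu> times the entry
  (\<nu>, \<mu>) of the Lorentz matrix, and g_\<nu>\<nu> cancels against the one in
  \<open>soldering\<close>.\<close>

lemma soldering_covariant:
  assumes M: "M \<in> SL2C" and "\<mu> < 4" "i < 2" "j < 2"
  shows "(\<Sum>a<2. \<Sum>b<2. soldering \<mu> a b * (M $$ (i, a) * adj_inv M $$ (j, b))) =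
    (\<Sum>\<nu><4. complex_of_real (lorentz_low M \<nu> \<mu>) * soldering \<nu> i j)"
proof -
  note Mc = SL2C_D(1)[OF M]
  let ?X = "\<lambda>\<nu>. momentum_mat (unit_vec 4 \<nu>)"
  define L where "L = lorentz M"
  have L: "L \<in> carrier_mat 4 4" "momentum_mat (L *\<^sub>v unit_vec 4 \<mu>) = M * ?X \<mu> * mat_adjoint M"
    using covers_lorentz[OF Mc] by (auto simp: covers_def L_def)
  have g: "lorentz_low M \<nu> \<mu> = minkowski \<nu> \<nu> * minkowski \<mu> \<mu> * L $$ (\<nu>, \<mu>)" if "\<nu> < 4" for \<nu>
  proof -
    have "lorentz_low M \<nu> \<mu> = (\<Sum>\<rho><4. if \<rho> = \<nu> then \<Sum>\<sigma><4. if \<sigma> = \<mu>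
      then minkowski \<nu> \<nu> * minkowski \<mu> \<mu> * L $$ (\<nu>, \<mu>) else 0 else 0)"
    proof (unfold lorentz_low_def L_def[symmetric], rule sum.cong[OF refl])
      fix \<rho>
      show "(\<Sum>\<sigma><4. minkowski \<nu> \<rho> * minkowski \<mu> \<sigma> * L $$ (\<rho>, \<sigma>)) =
        (if \<rho> = \<nu> then \<Sum>\<sigma><4. if \<sigma> = \<mu> then minkowski \<nu> \<nu> * minkowski \<mu> \<mu> * L $$ (\<nu>, \<mu>) else 0 else 0)"
      proof (cases "\<rho> = \<nu>")
        case True
        have "minkowski \<nu> \<nu> * minkowski \<mu> \<sigma> * L $$ (\<nu>, \<sigma>) =
          (if \<sigma> = \<mu> then minkowski \<nu> \<nu> * minkowski \<mu> \<mu> * L $$ (\<nu>, \<mu>) else 0)" for \<sigma>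
          by (simp add: minkowski_def)
        with True show ?thesis by simp
      qed (simp add: minkowski_def)
    qed
    then show ?thesis using that assms(2) by (simp add: sum.delta)
  qed
  have gg: "minkowski \<nu> \<nu> * minkowski \<nu> \<nu> = 1" for \<nu> by (simp add: minkowski_def)
  have X: "(\<Sum>\<nu><4. complex_of_real (L $$ (\<nu>, \<mu>)) * ?X \<nu> $$ (i, k)) =
    (M $$ (i, 0) * ?X \<mu> $$ (0, 0) + M $$ (i, 1) * ?X \<mu> $$ (1, 0)) * cnj (M $$ (k, 0)) +
    (M $$ (i, 0) * ?X \<mu> $$ (0, 1) + M $$ (i, 1) * ?X \<mu> $$ (1, 1)) * cnj (M $$ (k, 1))" if "k < 2" for k
  proof -
    have "(\<Sum>\<nu><4. complex_of_real (L $$ (\<nu>, \<mu>)) * ?X \<nu> $$ (i, k)) = (M * ?X \<mu> * mat_adjoint M) $$ (i, k)"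
      using momentum_mat_sum[OF L(1) assms(2,3) that] L(2) by simp
    also have "\<dots> = (M * ?X \<mu>) $$ (i, 0) * cnj (M $$ (k, 0)) + (M * ?X \<mu>) $$ (i, 1) * cnj (M $$ (k, 1))"
      using Mc that assms(3) by (subst mat2_mult_index) (auto simp: mat_adjoint_index[OF Mc] intro!: mult_carrier_mat)
    finally show ?thesis using Mc assms(3) by (simp add: mat2_mult_index)
  qed
  have "complex_of_real (lorentz_low M \<nu> \<mu>) * soldering \<nu> i j = complex_of_real (minkowski \<mu> \<mu>) *
    (if j = 0 then - (complex_of_real (L $$ (\<nu>, \<mu>)) * ?X \<nu> $$ (i, 1)) else complex_of_real (L $$ (\<nu>, \<mu>)) * ?X \<nu> $$ (i, 0))"
    if "\<nu> < 4" for \<nu>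
  proof -
    have "complex_of_real (minkowski \<nu> \<nu>) * complex_of_real (minkowski \<nu> \<nu>) = 1"
      using gg[of \<nu>] by (metis of_real_mult of_real_1)
    then show ?thesis
      by (simp add: g[OF that] soldering_def)
  qed
  then have "(\<Sum>\<nu><4. complex_of_real (lorentz_low M \<nu> \<mu>) * soldering \<nu> i j) = complex_of_real (minkowski \<mu> \<mu>) *
    (if j = 0 then - (\<Sum>\<nu><4. complex_of_real (L $$ (\<nu>, \<mu>)) * ?X \<nu> $$ (i, 1))
     else (\<Sum>\<nu><4. complex_of_real (L $$ (\<nu>, \<mu>)) * ?X \<nu> $$ (i, 0)))"
    by (simp add: sum_distrib_left sum_negf)
  \<comment> \<open>Multiplication by eps from the right exchanges the two columns and negates the
    new first one; hence column 1 of X is needed for j = 0 and column 0 for j = 1.\<close>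
  also have "\<dots> = (\<Sum>a<2. \<Sum>b<2. soldering \<mu> a b * (M $$ (i, a) * adj_inv M $$ (j, b)))"
  proof -
    have "j = 0 \<or> j = Suc 0" using assms(4) by auto
    then show ?thesis
      using X[of 0] X[of 1]
      by (auto simp: numeral_2_eq_2 soldering_def adj_inv_index[simplified] algebra_simps)
  qed
  finally show ?thesis ..
qed

section \<open>Entries of the (A, B) representation and of its adjoint\<close>

lemma kronecker_index:
  assumes "P \<in> carrier_mat m n" "Q \<in> carrier_mat m' n'" "i < m * m'" "j < n * n'"
  shows "kronecker P Q $$ (i, j) = P $$ (i div m', j div n') * Q $$ (i mod m', j mod n')"
  using assms by (simp add: kronecker_def)

lemma spin_rep2_index:
  assumes "M \<in> SL2C" "i < spin_dim A B" "j < spin_dim A B"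
  shows "spin_rep2 A B M $$ (i, j) =
    spin_rep A M $$ (i div (twice B + 1), j div (twice B + 1)) *
    spin_rep B (adj_inv M) $$ (i mod (twice B + 1), j mod (twice B + 1))"
  using assms(2,3) unfolding spin_rep2_def mat_inverse_mat_adjoint[OF assms(1)] option.sel spin_dim_def
  by (rule kronecker_index[OF spin_rep_carrier spin_rep_carrier])

lemma spin_rep2_carrier [simp]: "spin_rep2 A B M \<in> carrier_mat (spin_dim A B) (spin_dim A B)"
  by (rule carrier_matI) (simp_all only: spin_rep2_def kronecker_def spin_dim_def dim_row_mat dim_col_mat
    carrier_matD[OF spin_rep_carrier])

text \<open>Adjoints commute with Kronecker products and, by \<open>spin_rep_adjoint\<close>, with
  \<open>spin_rep\<close>. In this form the factors are spin matrices at N^(-1) and M^(-1), ready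
  for \<open>cg_covariant\<close>.\<close>

lemma spin_rep2_adjoint_index:
  assumes "M \<in> SL2C" "i < spin_dim C D" "j < spin_dim C D"
  shows "mat_adjoint (spin_rep2 C D M) $$ (i, j) =
    spin_rep C (mat_adjoint M) $$ (i div (twice D + 1), j div (twice D + 1)) *
    spin_rep D (mat_adjoint (adj_inv M)) $$ (i mod (twice D + 1), j mod (twice D + 1))"
proof -
  have *: "i div (twice D + 1) < twice C + 1" if "i < spin_dim C D" for i
    using that by (simp add: spin_dim_def less_mult_imp_div_less)
  have **: "i mod (twice D + 1) < twice D + 1" for i by simp
  show ?thesis
    unfolding spin_rep_adjoint[OF SL2C_D(1)[OF assms(1)]] spin_rep_adjoint[OF adj_inv_carrier]
    by (simp only: mat_adjoint_index[OF spin_rep_carrier * *] mat_adjoint_index[OF spin_rep_carrier ** **]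
      mat_adjoint_index[OF spin_rep2_carrier] spin_rep2_index assms complex_cnj_mult)
qed

lemma sum_lessThan_times_times:
  fixes f :: "nat \<Rightarrow> nat \<Rightarrow> nat \<Rightarrow> nat \<Rightarrow> 'a :: comm_monoid_add"
  shows "(\<Sum>u<m * n. \<Sum>v<m' * n'. f (u div n) (u mod n) (v div n') (v mod n')) =
    (\<Sum>i<m. \<Sum>j<n. \<Sum>k<m'. \<Sum>l<n'. f i j k l)"
proof -
  have "(\<Sum>v<m' * n'. f (u div n) (u mod n) (v div n') (v mod n')) =
    (\<Sum>k<m'. \<Sum>l<n'. f (u div n) (u mod n) k l)" for u
    by (rule sum_lessThan_times)
  then show ?thesis
    by (simp only:) (rule sum_lessThan_times)
qed

text \<open>The rows (i, j) and columns (k, l) of a Kronecker product are regrouped as (i, l) for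
  \<open>P\<close> and (j, k) for \<open>Q\<close>, so that the fourfold contraction splits into two
  independent ones.\<close>

lemma spinor_sum_bilinear:
  "(\<Sum>i\<in>I. \<Sum>j\<in>J. \<Sum>k\<in>K. \<Sum>l\<in>L. a i * b j * spinor_sum n (\<lambda>x y. P x i l * Q y j k) \<mu> * (c k * d l)) =
    spinor_sum n (\<lambda>x y. (\<Sum>i\<in>I. \<Sum>l\<in>L. a i * P x i l * d l) * (\<Sum>j\<in>J. \<Sum>k\<in>K. b j * Q y j k * c k)) \<mu>"
proof -
  let ?S = "\<lambda>x y. \<Prod>h<n. soldering (\<mu> ! h) (x ! h) (y ! h)"
  let ?f = "\<lambda>x y i j k l. (a i * P (sum_list x) i l * d l) * (b j * Q (sum_list y) j k * c k)"
  have "a i * b j * spinor_sum n (\<lambda>x y. P x i l * Q y j k) \<mu> * (c k * d l) =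
      (\<Sum>x\<in>tuples 2 n. \<Sum>y\<in>tuples 2 n. ?S x y * ?f x y i j k l)" for i j k l
    unfolding spinor_sum_def sum_distrib_left sum_distrib_right
    by (intro sum.cong refl) (simp only: mult_ac)
  then have "(\<Sum>i\<in>I. \<Sum>j\<in>J. \<Sum>k\<in>K. \<Sum>l\<in>L. a i * b j * spinor_sum n (\<lambda>x y. P x i l * Q y j k) \<mu> * (c k * d l)) =
    (\<Sum>i\<in>I. \<Sum>j\<in>J. \<Sum>k\<in>K. \<Sum>l\<in>L. \<Sum>x\<in>tuples 2 n. \<Sum>y\<in>tuples 2 n. ?S x y * ?f x y i j k l)"
    by (simp only:)
  also have "\<dots> = (\<Sum>i\<in>I. \<Sum>j\<in>J. \<Sum>x\<in>tuples 2 n. \<Sum>y\<in>tuples 2 n. \<Sum>k\<in>K. \<Sum>l\<in>L. ?S x y * ?f x y i j k l)"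
    by (intro sum.cong[OF refl, of I] sum.cong[OF refl, of J]) (rule sum_swap_2_2)
  also have "\<dots> = (\<Sum>x\<in>tuples 2 n. \<Sum>y\<in>tuples 2 n. \<Sum>i\<in>I. \<Sum>j\<in>J. \<Sum>k\<in>K. \<Sum>l\<in>L. ?S x y * ?f x y i j k l)"
    by (rule sum_swap_2_2)
  also have "\<dots> = (\<Sum>x\<in>tuples 2 n. \<Sum>y\<in>tuples 2 n. ?S x y *
     ((\<Sum>i\<in>I. \<Sum>l\<in>L. a i * P (sum_list x) i l * d l) * (\<Sum>j\<in>J. \<Sum>k\<in>K. b j * Q (sum_list y) j k * c k)))"
  proof -
    have "(\<Sum>i\<in>I. \<Sum>j\<in>J. \<Sum>k\<in>K. \<Sum>l\<in>L. s * (g i l * h j k)) =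
        s * ((\<Sum>i\<in>I. \<Sum>l\<in>L. g i l) * (\<Sum>j\<in>J. \<Sum>k\<in>K. h j k))" for s :: complex and g h
      by (simp only: sum_distrib_left[symmetric] sum_distrib_right[symmetric])
    then show ?thesis by (simp only:)
  qed
  finally show ?thesis by (simp only: spinor_sum_def)
qed

text \<open>Tuples of length n over {0, 1} have sum at most n; \<open>cg_covariant\<close> is
  available for such component numbers only.\<close>

lemma spinor_sum_cong:
  assumes "\<And>x y. x \<le> n \<Longrightarrow> y \<le> n \<Longrightarrow> G x y = G' x y"
  shows "spinor_sum n G \<mu> = spinor_sum n G' \<mu>"
proof -
  have "sum_list x \<le> n" if "x \<in> tuples 2 n" for x
  proof -
    have "length x = n" "\<And>a. a \<in> set x \<Longrightarrow> a \<le> 1" using that by (auto simp: tuples_def)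
    then show ?thesis using sum_list_mono[of x "\<lambda>a. a" "\<lambda>_. 1"] by (simp add: sum_list_triv)
  qed
  then show ?thesis
    unfolding spinor_sum_def by (intro sum.cong refl) (simp add: assms)
qed

text \<open>The solution is p = A + K - D, q = A + D - K, r = D + K - A: the triangle inequalities
  make these nonnegative, and the parity condition makes them integers.\<close>

lemma obtain_triangle_parts:
  assumes "A \<in> half_integers_nonneg" "D \<in> half_integers_nonneg" "K \<in> half_integers_nonneg"
    and "even (twice K) \<longleftrightarrow> even (twice A + twice D)" "\<bar>A - D\<bar> \<le> K" "K \<le> A + D"
  obtains p q r where "twice A = p + q" "twice D = q + r" "twice K = p + r"
proof -
  obtain a d k where A: "A = real a / 2" "D = real d / 2" "K = real k / 2"
    using assms(1-3) by (auto simp: half_integers_nonneg_def)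
  have e: "even k \<longleftrightarrow> even (a + d)" using assms(4) unfolding A twice_half .
  have "k \<le> a + d" "a \<le> k + d" "d \<le> k + a"
    using assms(5,6) unfolding A by linarith+
  moreover from this e have "even (a + k - d)" "even (a + d - k)" "even (d + k - a)"
    by auto
  then obtain p q r where "a + k - d = 2 * p" "a + d - k = 2 * q" "d + k - a = 2 * r"
    unfolding dvd_def by blast
  ultimately have "a = p + q" "d = q + r" "k = p + r"
    by linarith+
  then show ?thesis using that[of p q r] by (simp only: A twice_half)
qed

theorem mainTheorem6:
  fixes A B C D K :: real
  assumes "A \<in> half_integers_nonneg" and "B \<in> half_integers_nonneg"
    and "C \<in> half_integers_nonneg" and "D \<in> half_integers_nonneg"
    and "K \<in> half_integers_nonneg"
    and "even (twice K) \<longleftrightarrow> even (twice A + twice D)"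
    and "even (twice K) \<longleftrightarrow> even (twice B + twice C)"
    and "max \<bar>A - D\<bar> \<bar>B - C\<bar> \<le> K" and "K \<le> min (A + D) (B + C)"
  shows "\<exists>T :: nat list \<Rightarrow> complex mat.
    (\<forall>\<mu> \<in> multi_indices (twice K). T \<mu> \<in> carrier_mat (spin_dim A B) (spin_dim C D)) \<and>
    (\<exists>\<mu> \<in> multi_indices (twice K). T \<mu> \<noteq> 0\<^sub>m (spin_dim A B) (spin_dim C D)) \<and>
    symmetric_tensor (twice K) T \<and>
    traceless_tensor (spin_dim A B) (spin_dim C D) (twice K) T \<and>
    (\<forall>\<Lambda> \<in> SL2C. \<forall>\<mu> \<in> multi_indices (twice K).
      spin_rep2 A B \<Lambda> * T \<mu> * mat_adjoint (spin_rep2 C D \<Lambda>) =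
      mat_sum (spin_dim A B) (spin_dim C D)
        (\<lambda>\<nu>. complex_of_real (\<Prod>j<twice K. lorentz_low \<Lambda> (\<nu> ! j) (\<mu> ! j)) \<cdot>\<^sub>m T \<nu>)
        (multi_indices (twice K)))"
proof -
  obtain p q r where pqr: "twice A = p + q" "twice D = q + r" "twice K = p + r"
    using obtain_triangle_parts[of A D K] assms by auto
  obtain p' q' r' where pqr': "twice B = p' + q'" "twice C = q' + r'" "twice K = p' + r'"
    using obtain_triangle_parts[of B C K] assms by auto
  let ?n = "twice K" and ?b = "twice B + 1" and ?d = "twice D + 1"
  define P where "P = cg p q r"
  define Q where "Q = cg p' q' r'"
  \<comment> \<open>Here i, j, k, l belong to A, B, C, D, so \<open>P\<close> couples A with D and
    \<open>Q\<close> couples B with C.\<close>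
  define t where "t \<mu> i j k l = spinor_sum ?n (\<lambda>x y. P x i l * Q y j k) \<mu>" for \<mu> i j k l
  define T where "T \<mu> = mat (spin_dim A B) (spin_dim C D)
    (\<lambda>(u, v). t \<mu> (u div ?b) (u mod ?b) (v div ?d) (v mod ?d))" for \<mu>
  have T: "T \<mu> \<in> carrier_mat (spin_dim A B) (spin_dim C D)" for \<mu> by (simp add: T_def)
  have T_index: "T \<mu> $$ (u, v) = t \<mu> (u div ?b) (u mod ?b) (v div ?d) (v mod ?d)"
    if "u < spin_dim A B" "v < spin_dim C D" for \<mu> u v
    using that by (simp add: T_def)
  have "\<exists>\<mu> \<in> multi_indices ?n. T \<mu> \<noteq> 0\<^sub>m (spin_dim A B) (spin_dim C D)"
  proof (rule ccontr)
    assume "\<not> (\<exists>\<mu> \<in> multi_indices ?n. T \<mu> \<noteq> 0\<^sub>m (spin_dim A B) (spin_dim C D))"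
    then have T0: "T \<mu> = 0\<^sub>m (spin_dim A B) (spin_dim C D)" if "\<mu> \<in> tuples 4 ?n" for \<mu>
      using that by (auto simp: multi_indices_tuples)
    have pos: "0 < spin_dim A B" "0 < spin_dim C D" by (simp_all add: spin_dim_def)
    \<comment> \<open>This one entry suffices, as it involves just the components with a = b = 0
      evaluated in \<open>sum_binomial_cg\<close>.\<close>
    have t0: "t \<mu> 0 0 0 0 = 0" if "\<mu> \<in> tuples 4 ?n" for \<mu>
      using T_index[OF pos, of \<mu>] T0[OF that] pos by simp
    (* chosen so that the combination of soldering matrices is the all-ones matrix, which turns the
       double sum into a product of two evaluations of trilinear forms *)
    define c where "c \<alpha> = (if \<alpha> = 2 then \<i> else if \<alpha> = 3 then - 1 else 0)" for \<alpha> :: nat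
    have c: "(\<Sum>\<alpha><4. c \<alpha> * soldering \<alpha> a b) = 1" if "a < 2" "b < 2" for a b
    proof -
      have "a = 0 \<or> a = Suc 0" "b = 0 \<or> b = Suc 0" using that by auto
      then show ?thesis by (auto simp: numeral_eq_Suc soldering_values c_def)
    qed
    have ones: "(\<Sum>x\<in>tuples 2 ?n. g (sum_list x)) = (\<Sum>m\<le>?n. of_nat (?n choose m) * g m)" for g :: "nat \<Rightarrow> complex"
      using sum_prod_tuples_2[where n = ?n and f = "\<lambda>_ _. 1 :: complex" and g = g]
      by (simp add: coeff_linear_poly_power)
    have "(\<Sum>x\<in>tuples 2 ?n. P (sum_list x) 0 0) = 1"
      using sum_binomial_cg[of p r q] unfolding ones[of "\<lambda>m. P m 0 0"] unfolding P_def pqr(3) .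
    moreover have "(\<Sum>y\<in>tuples 2 ?n. Q (sum_list y) 0 0) = 1"
      using sum_binomial_cg[of p' r' q'] unfolding ones[of "\<lambda>m. Q m 0 0"] unfolding Q_def pqr'(3) .
    moreover have "(\<Sum>\<mu>\<in>tuples 4 ?n. (\<Prod>h<?n. c (\<mu> ! h)) * t \<mu> 0 0 0 0) =
      (\<Sum>x\<in>tuples 2 ?n. \<Sum>y\<in>tuples 2 ?n. P (sum_list x) 0 0 * Q (sum_list y) 0 0)"
      unfolding t_def sum_prod_spinor_sum[where c = "\<lambda>_. c"]
      by (intro sum.cong refl) (simp add: c tuples_nth)
    moreover have "\<dots> = (\<Sum>x\<in>tuples 2 ?n. P (sum_list x) 0 0) * (\<Sum>y\<in>tuples 2 ?n. Q (sum_list y) 0 0)"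
      by (simp only: sum_product)
    ultimately show False by (simp add: t0)
  qed
  moreover have "symmetric_tensor ?n T"
    unfolding symmetric_tensor_def multi_indices_def
    by (auto simp: T_def t_def spinor_sum_permute)
  moreover have "traceless_tensor (spin_dim A B) (spin_dim C D) ?n T"
    unfolding traceless_tensor_def
  proof (intro impI ballI)
    fix \<mu> assume "2 \<le> ?n"
    then obtain m where n: "?n = Suc (Suc m)" by (metis add_2_eq_Suc le_Suc_ex)
    show "mat_sum (spin_dim A B) (spin_dim C D) (\<lambda>(\<alpha>, \<beta>). complex_of_real (minkowski \<alpha> \<beta>) \<cdot>\<^sub>m T (\<alpha> # \<beta> # \<mu>))
          ({..<4} \<times> {..<4}) = 0\<^sub>m (spin_dim A B) (spin_dim C D)"
    proof (rule eq_matI)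
      fix u v assume "u < dim_row (0\<^sub>m (spin_dim A B) (spin_dim C D) :: complex mat)"
        "v < dim_col (0\<^sub>m (spin_dim A B) (spin_dim C D) :: complex mat)"
      then have uv: "u < spin_dim A B" "v < spin_dim C D" by simp_all
      have "(\<Sum>\<alpha><4. \<Sum>\<beta><4. (complex_of_real (minkowski \<alpha> \<beta>) \<cdot>\<^sub>m T (\<alpha> # \<beta> # \<mu>)) $$ (u, v)) =
        (\<Sum>\<alpha><4. \<Sum>\<beta><4. complex_of_real (minkowski \<alpha> \<beta>) *
          t (\<alpha> # \<beta> # \<mu>) (u div ?b) (u mod ?b) (v div ?d) (v mod ?d))"
        using uv T by (intro sum.cong refl) (simp add: T_index carrier_matD[OF T])
      also have "\<dots> = 0"
        unfolding t_def n by (rule spinor_sum_traceless)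
      finally show "mat_sum (spin_dim A B) (spin_dim C D) (\<lambda>(\<alpha>, \<beta>). complex_of_real (minkowski \<alpha> \<beta>) \<cdot>\<^sub>m T (\<alpha> # \<beta> # \<mu>))
          ({..<4} \<times> {..<4}) $$ (u, v) = 0\<^sub>m (spin_dim A B) (spin_dim C D) $$ (u, v)"
        using uv by (simp add: mat_sum_def sum.cartesian_product case_prod_unfold)
    qed (simp_all add: mat_sum_def)
  qed
  moreover have "spin_rep2 A B M * T \<mu> * mat_adjoint (spin_rep2 C D M) =
      mat_sum (spin_dim A B) (spin_dim C D)
        (\<lambda>\<nu>. complex_of_real (\<Prod>j<?n. lorentz_low M (\<nu> ! j) (\<mu> ! j)) \<cdot>\<^sub>m T \<nu>) (multi_indices ?n)"
    if M: "M \<in> SL2C" and \<mu>: "\<mu> \<in> multi_indices ?n" for M \<mu>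
  proof -
    let ?N = "adj_inv M"
    let ?R = "spin_rep2 A B M" and ?S = "mat_adjoint (spin_rep2 C D M)"
    have S: "?S \<in> carrier_mat (spin_dim C D) (spin_dim C D)" by simp
    note Mc = SL2C_D[OF M]
    have Mdet: "?N $$ (0, 0) * ?N $$ (1, 1) - ?N $$ (0, 1) * ?N $$ (1, 0) = 1"
    proof -
      have "cnj (M $$ (0, 0) * M $$ (1, 1) - M $$ (0, 1) * M $$ (1, 0)) = 1" by (simp only: Mc) simp
      then show ?thesis by (simp add: adj_inv_index[simplified] algebra_simps)
    qed
    have t_cov: "(\<Sum>i'\<le>p + q. \<Sum>j'\<le>p' + q'. \<Sum>k'\<le>q' + r'. \<Sum>l'\<le>q + r.
        spin_rep A M $$ (i, i') * spin_rep B ?N $$ (j, j') * t \<mu> i' j' k' l' *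
        (spin_rep C (mat_adjoint M) $$ (k', k) * spin_rep D (mat_adjoint ?N) $$ (l', l))) =
      (\<Sum>\<nu>\<in>tuples 4 ?n. complex_of_real (\<Prod>h<?n. lorentz_low M (\<nu> ! h) (\<mu> ! h)) * t \<nu> i j k l)"
      if ijkl: "i \<le> p + q" "j \<le> p' + q'" "k \<le> q' + r'" "l \<le> q + r" for i j k l
    proof -
      \<comment> \<open>The adjoint of N is the adjugate of M.\<close>
      have P: "(\<Sum>i'\<le>p + q. \<Sum>l'\<le>q + r. spin_rep A M $$ (i, i') * P x i' l' * spin_rep D (mat_adjoint ?N) $$ (l', l)) =
        (\<Sum>m\<le>?n. coeff (spin_poly ?n M x) m * P m i l)" if "x \<le> ?n" for x
        unfolding P_def pqr(3) using that ijkl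
        by (intro cg_covariant) (simp_all add: pqr[symmetric] Mc(2)[simplified] mat_adjoint_index[of _ 2 2] adj_inv_index[simplified])
      \<comment> \<open>The same with N in place of M, because the adjoint of M is the adjugate of
        N.\<close>
      have Q: "(\<Sum>j'\<le>p' + q'. \<Sum>k'\<le>q' + r'. spin_rep B ?N $$ (j, j') * Q y j' k' * spin_rep C (mat_adjoint M) $$ (k', k)) =
        (\<Sum>m\<le>?n. coeff (spin_poly ?n ?N y) m * Q m j k)" if "y \<le> ?n" for y
        unfolding Q_def pqr'(3) using that ijkl
        by (intro cg_covariant) (simp_all add: pqr'[symmetric] Mdet[unfolded adj_inv_index, simplified] mat_adjoint_index[OF Mc(1)] adj_inv_index[simplified])
      have "(\<Sum>i'\<le>p + q. \<Sum>j'\<le>p' + q'. \<Sum>k'\<le>q' + r'. \<Sum>l'\<le>q + r.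
        spin_rep A M $$ (i, i') * spin_rep B ?N $$ (j, j') * t \<mu> i' j' k' l' *
        (spin_rep C (mat_adjoint M) $$ (k', k) * spin_rep D (mat_adjoint ?N) $$ (l', l))) =
        spinor_sum ?n (\<lambda>x y. (\<Sum>m\<le>?n. coeff (spin_poly ?n M x) m * P m i l) *
          (\<Sum>m\<le>?n. coeff (spin_poly ?n ?N y) m * Q m j k)) \<mu>"
        unfolding t_def spinor_sum_bilinear by (rule spinor_sum_cong) (simp only: P Q)
      also have "\<dots> = spinor_sum ?n (\<lambda>x y. \<Sum>m\<le>?n. \<Sum>m'\<le>?n. coeff (spin_poly ?n M x) m *
          coeff (spin_poly ?n ?N y) m' * (P m i l * Q m' j k)) \<mu>"
        by (simp only: sum_product mult_ac)
      also have "\<dots> = (\<Sum>x\<in>tuples 2 ?n. \<Sum>y\<in>tuples 2 ?n.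
          (\<Prod>h<?n. \<Sum>\<nu><4. complex_of_real (lorentz_low M \<nu> (\<mu> ! h)) * soldering \<nu> (x ! h) (y ! h)) *
          (P (sum_list x) i l * Q (sum_list y) j k))"
        unfolding spinor_sum_transform using \<mu>
        by (intro sum.cong refl arg_cong2[where f = "(*)"] prod.cong soldering_covariant M)
          (auto simp: multi_indices_tuples tuples_nth)
      also have "\<dots> = (\<Sum>\<nu>\<in>tuples 4 ?n. complex_of_real (\<Prod>h<?n. lorentz_low M (\<nu> ! h) (\<mu> ! h)) * t \<nu> i j k l)"
        unfolding t_def of_real_prod
        by (rule sum_prod_spinor_sum[where c = "\<lambda>h \<nu>. complex_of_real (lorentz_low M \<nu> (\<mu> ! h))", symmetric])
      finally show ?thesis .
    qed
    show ?thesis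
    proof (rule eq_matI)
      fix u v
      let ?rhs = "mat_sum (spin_dim A B) (spin_dim C D)
        (\<lambda>\<nu>. complex_of_real (\<Prod>j<?n. lorentz_low M (\<nu> ! j) (\<mu> ! j)) \<cdot>\<^sub>m T \<nu>) (multi_indices ?n)"
      assume "u < dim_row ?rhs" "v < dim_col ?rhs"
      then have uv: "u < spin_dim A B" "v < spin_dim C D" by (simp_all add: mat_sum_def)
      let ?i = "u div ?b" and ?j = "u mod ?b" and ?k = "v div ?d" and ?l = "v mod ?d"
      have ijkl: "?i \<le> p + q" "?j \<le> p' + q'" "?k \<le> q' + r'" "?l \<le> q + r"
        using uv less_mult_imp_div_less[of u "twice A + 1" ?b] less_mult_imp_div_less[of v "twice C + 1" ?d]
          mod_less_divisor[of ?b u] mod_less_divisor[of ?d v]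
        by (simp_all add: spin_dim_def pqr pqr' del: mod_less_divisor)
      have "(?R * T \<mu> * ?S) $$ (u, v) = (\<Sum>v'<spin_dim C D. (?R * T \<mu>) $$ (u, v') * ?S $$ (v', v))"
        using uv T[of \<mu>] S carrier_matD[OF S] carrier_matD[OF spin_rep2_carrier[of A B M]] carrier_matD[OF T[of \<mu>]]
        by (simp add: scalar_prod_def atLeast0LessThan)
      also have "\<dots> = (\<Sum>v'<spin_dim C D. \<Sum>u'<spin_dim A B. ?R $$ (u, u') * T \<mu> $$ (u', v') * ?S $$ (v', v))"
        using uv carrier_matD[OF spin_rep2_carrier[of A B M]] carrier_matD[OF T[of \<mu>]]
        by (intro sum.cong refl) (simp add: scalar_prod_def atLeast0LessThan sum_distrib_right)
      also have "\<dots> = (\<Sum>u'<spin_dim A B. \<Sum>v'<spin_dim C D. ?R $$ (u, u') * T \<mu> $$ (u', v') * ?S $$ (v', v))"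
        by (rule sum.swap)
      also have "\<dots> = (\<Sum>u'<spin_dim A B. \<Sum>v'<spin_dim C D.
          spin_rep A M $$ (?i, u' div ?b) * spin_rep B ?N $$ (?j, u' mod ?b) *
          t \<mu> (u' div ?b) (u' mod ?b) (v' div ?d) (v' mod ?d) *
          (spin_rep C (mat_adjoint M) $$ (v' div ?d, ?k) * spin_rep D (mat_adjoint ?N) $$ (v' mod ?d, ?l)))"
        using uv by (intro sum.cong refl)
          (simp only: spin_rep2_index[OF M] spin_rep2_adjoint_index[OF M] T_index lessThan_iff)
      \<comment> \<open>Quotient and remainder run independently over the index ranges of the
        Kronecker factors.\<close>
      also have "\<dots> = (\<Sum>i'<twice A + 1. \<Sum>j'<?b. \<Sum>k'<twice C + 1. \<Sum>l'<?d.
          spin_rep A M $$ (?i, i') * spin_rep B ?N $$ (?j, j') * t \<mu> i' j' k' l' *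
          (spin_rep C (mat_adjoint M) $$ (k', ?k) * spin_rep D (mat_adjoint ?N) $$ (l', ?l)))"
        unfolding spin_dim_def by (rule sum_lessThan_times_times)
      also have "\<dots> = (\<Sum>\<nu>\<in>tuples 4 ?n. complex_of_real (\<Prod>h<?n. lorentz_low M (\<nu> ! h) (\<mu> ! h)) * t \<nu> ?i ?j ?k ?l)"
        using t_cov[OF ijkl] pqr(1,2) pqr'(1,2) by (simp only: Suc_eq_plus1[symmetric] lessThan_Suc_atMost)
      also have "\<dots> = ?rhs $$ (u, v)"
        using uv by (simp add: mat_sum_def multi_indices_tuples T_index carrier_matD[OF T])
      finally show "(?R * T \<mu> * ?S) $$ (u, v) = ?rhs $$ (u, v)" .
    qed (use carrier_matD[OF S] carrier_matD[OF spin_rep2_carrier[of A B M]] in \<open>simp_all add: mat_sum_def\<close>)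
  qed
  ultimately show ?thesis using T by blast
qed

end
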